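(* For any function $f\in W_2^{k+1}(I_j)$, one has $$\| f-\mathcal P_h^C(f)\|_{L^2(I_j)}\le C_{k+1}(\Delta x)^{k+1}|f|_{W_2^{k+1}(I_j)},$$ where $C_{k+1}$ is a constant depending only on $k$.
   Context: The spatial domain $\Omega\subset\mathbb R$ is uniformly divided into cells $I_j=(x_{j-\frac12},x_{j+\frac12})$ of length $\Delta x=x_{j+\frac12}-x_{j-\frac12}$, with midpoints $x_j=\frac12(x_{j-\frac12}+x_{j+\frac12})$, and $I_j^-=(x_{j-\frac12},x_j)$. Let $\mathbb P^k(I_j)$ be the space of polynomials of degree at most $k$ on $I_j$, and $\mathbb V_h^{C,k}=\{v\in L^2(\Omega): v|_{I_j}\in\mathbb P^k(I_j)\ \forall j\}$. On each $I_j$ let $\{\Phi_i\}_{i=0}^k$ be the orthogonal basis of $\mathbb P^k(I_j)$ given by the monic (scaled) Legendre polynomials in $\xi=2(x-x_j)/\Delta x$: $\Phi_0=1$, $\Phi_1=\xi$, $\Phi_2=\xi^2-\frac13$, $\Phi_3=\xi^3-\frac35\xi$, etc. The operator $\mathcal P_h^C:L^2(\Omega)\to\mathbb V_h^{C,k}$ is uniquely defined by requiring on each cell $I_j$ $$\int_{I_j^-}\mathcal P_h^C(f)\,dx=\int_{I_j^-}f\,dx,\qquad \int_{I_j}\mathcal P_h^C(f)\,v\,dx=\int_{I_j}f\,v\,dx\quad\forall v\in\mathrm{span}\{\Phi_0,\Phi_2,\Phi_3,\dots,\Phi_k\}.$$ The restriction of $\mathcal P_h^C(f)$ to $I_j$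 depends only on $f|_{I_j}$, so $\mathcal P_h^C(f)$ on $I_j$ makes sense for $f\in L^2(I_j)$. $W_2^{k+1}(I_j)$ is the standard ($L^2$-based) Sobolev space of order $k+1$ and $|f|_{W_2^{k+1}(I_j)}=\|f^{(k+1)}\|_{L^2(I_j)}$ is its seminorm of order $k+1$. *)

theory Defs
  imports "HOL-Analysis.Analysis" "HOL-Computational_Algebra.Polynomial"
begin

section \<open>Square-integrable functions and Sobolev spaces on an open subset of the line\<close>

text \<open>
  Functions are not identified almost everywhere: an element of the usual \<open>L\<^sup>2(S)\<close> or \<open>W\<^sub>2\<^sup>m(S)\<close>
  is given by any of its representatives, and values outside \<open>S\<close> are irrelevant.
\<close>

definition L2_space :: "real set \<Rightarrow> (real \<Rightarrow> real) set" where
  "L2_space S = {f. f \<in> borel_measurable (lebesgue_on S) \<and> set_integrable lebesgue S (\<lambda>x. (f x)\<^sup>2)}"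

definition L2_norm :: "real set \<Rightarrow> (real \<Rightarrow> real) \<Rightarrow> real" where
  "L2_norm S f = sqrt (LINT x:S|lebesgue. (f x)\<^sup>2)"

text \<open>Smooth functions on the line with compact support contained in \<open>S\<close>.\<close>

definition test_functions :: "real set \<Rightarrow> (real \<Rightarrow> real) set" where
  "test_functions S = {\<phi>. (\<forall>n x. (deriv ^^ n) \<phi> field_differentiable at x) \<and>
     (\<exists>K. compact K \<and> K \<subseteq> S \<and> (\<forall>x. x \<notin> K \<longrightarrow> \<phi> x = 0))}"

definition locally_integrable_on :: "(real \<Rightarrow> real) \<Rightarrow> real set \<Rightarrow> bool" where
  "locally_integrable_on f S \<longleftrightarrow> (\<forall>K. compact K \<and> K \<subseteq> S \<longrightarrow> set_integrable lebesgue K f)"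

definition has_weak_derivative ::
    "nat \<Rightarrow> real set \<Rightarrow> (real \<Rightarrow> real) \<Rightarrow> (real \<Rightarrow> real) \<Rightarrow> bool" where
  "has_weak_derivative m S f g \<longleftrightarrow>
     locally_integrable_on f S \<and> locally_integrable_on g S \<and>
     (\<forall>\<phi>\<in>test_functions S.
        (LINT x:S|lebesgue. f x * (deriv ^^ m) \<phi> x) = (-1) ^ m * (LINT x:S|lebesgue. g x * \<phi> x))"

text \<open>
  On an open set the weak derivative is unique up to a null set; the choice below picks one
  representative.
\<close>

definition weak_derivative :: "nat \<Rightarrow> real set \<Rightarrow> (real \<Rightarrow> real) \<Rightarrow> real \<Rightarrow> real" where
  "weak_derivative m S f = (SOME g. has_weak_derivative m S f g)"

definition Sobolev_space :: "nat \<Rightarrow> real set \<Rightarrow> (real \<Rightarrow> real) set" where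
  "Sobolev_space m S =
     {f \<in> L2_space S. \<forall>i\<in>{1..m}. \<exists>g\<in>L2_space S. has_weak_derivative i S f g}"

definition Sobolev_seminorm :: "nat \<Rightarrow> real set \<Rightarrow> (real \<Rightarrow> real) \<Rightarrow> real" where
  "Sobolev_seminorm m S f = L2_norm S (weak_derivative m S f)"

section \<open>The projection on a cell\<close>

text \<open>
  Rodrigues' formula, normalised to leading coefficient 1: the Legendre polynomial of degree \<open>n\<close>
  is \<open>1 / (2 ^ n * n!)\<close> times the \<open>n\<close>-th derivative of \<open>(\<xi>\<^sup>2 - 1) ^ n\<close>, and that derivative has
  leading coefficient \<open>(2 n)! / n!\<close>.
\<close>

definition monic_Legendre :: "nat \<Rightarrow> real poly" where
  "monic_Legendre n = smult (fact n / fact (2 * n)) ((pderiv ^^ n) ([:-1, 0, 1:] ^ n))"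

lemma monic_Legendre_values:
  "monic_Legendre 0 = 1"
  "monic_Legendre 1 = [:0, 1:]"
  "monic_Legendre 2 = [:- 1 / 3, 0, 1:]"
  "monic_Legendre 3 = [:0, - 3 / 5, 0, 1:]"
  by (simp_all add: monic_Legendre_def numeral_eq_Suc pderiv_pCons fact_numeral)

text \<open>
  The basis polynomial on the cell \<open>(a, b)\<close>, as a polynomial in \<open>x\<close>: the substitution is
  \<open>\<xi> = 2 * (x - (a + b) / 2) / (b - a)\<close>.
\<close>

definition cell_basis :: "real \<Rightarrow> real \<Rightarrow> nat \<Rightarrow> real poly" where
  "cell_basis a b i = pcompose (monic_Legendre i) [:- (a + b) / (b - a), 2 / (b - a):]"

definition is_cell_projection ::
    "nat \<Rightarrow> real \<Rightarrow> real \<Rightarrow> (real \<Rightarrow> real) \<Rightarrow> real poly \<Rightarrow> bool" where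
  "is_cell_projection k a b f p \<longleftrightarrow>
     degree p \<le> k \<and>
     (LINT x:{a<..<(a + b) / 2}|lebesgue. poly p x) = (LINT x:{a<..<(a + b) / 2}|lebesgue. f x) \<and>
     (\<forall>v\<in>module.span smult (cell_basis a b ` ({0..k} - {1})).
        (LINT x:{a<..<b}|lebesgue. poly p x * poly v x) = (LINT x:{a<..<b}|lebesgue. f x * poly v x))"

text \<open>
  The polynomial is unique only for \<open>k \<ge> 1\<close>; for \<open>k = 0\<close> the two conditions on the single
  coefficient are in general incompatible.
\<close>

definition cell_projection :: "nat \<Rightarrow> real \<Rightarrow> real \<Rightarrow> (real \<Rightarrow> real) \<Rightarrow> real \<Rightarrow> real" where
  "cell_projection k a b f = poly (THE p. is_cell_projection k a b f p)"

end

theory Submission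
  imports Defs
begin

text \<open>
  The estimate is an instance of the Bramble-Hilbert argument, with a constant that is explicit.
  
  The projection reproduces polynomials of degree at most \<open>k\<close>, so its error on \<open>f\<close> equals its error
  on \<open>e = f - p\<close> for every such polynomial \<open>p\<close>. On an arbitrary square-integrable \<open>e\<close> the error is at
  most \<open>5 (k + 2)\<close> times the norm of \<open>e\<close> (\<open>is_cell_projection_stable\<close>): the basis is orthogonal by
  Rodrigues' formula, hence the projection is an explicit sum whose terms are bounded by the
  Cauchy-Schwarz inequality with constants that do not depend on the cell. It remains to choose \<open>p\<close> with
  \<open>\<parallel>f - p\<parallel> \<le> h\<^sup>k\<^sup>+\<^sup>1 \<parallel>g\<parallel>\<close>, where \<open>h\<close> is the length of the cell and \<open>g\<close> the weak derivative of order \<open>k + 1\<close>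
  (\<open>polynomial_approximation\<close>).
  
  Such a \<open>p\<close> is the Taylor part of \<open>f\<close>, and it is found without pointwise derivatives, by lowering the
  order of the weak derivative: the primitive of the weak derivative of order \<open>m + 1\<close> is, up to a
  constant, a weak derivative of order \<open>m\<close> (\<open>weak_derivative_reduce_order\<close>), and its norm is smaller by
  a factor \<open>h\<close>. The constants are absorbed by monomials. At order 0 the remaining function has the same
  integral against every test function as \<open>f\<close> minus the collected monomials, so the two agree almost
  everywhere by the fundamental lemma of the calculus of variations
  (\<open>AE_zero_if_integral_test_functions_zero\<close>), which in turn rests on smooth bumps that
  approximate indicators of intervals. The same lemma makes weak derivatives unique up to null sets, so
  the seminorm is the norm of any of them.
\<close>

section \<open>Square-integrable functions\<close>

lemma set_integrable_iff_lebesgue_on: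
  fixes f :: "real \<Rightarrow> real"
  assumes "S \<in> sets lebesgue"
  shows "set_integrable lebesgue S f \<longleftrightarrow> integrable (lebesgue_on S) f"
  using assms by (simp add: set_integrable_def integrable_restrict_space)

lemma set_integral_eq_lebesgue_on:
  fixes f :: "real \<Rightarrow> real"
  assumes "S \<in> sets lebesgue"
  shows "(LINT x:S|lebesgue. f x) = integral\<^sup>L (lebesgue_on S) f"
  using assms by (simp add: set_lebesgue_integral_def integral_restrict_space)

lemma L2_space_iff:
  assumes "S \<in> sets lebesgue"
  shows "f \<in> L2_space S \<longleftrightarrow>
    f \<in> borel_measurable (lebesgue_on S) \<and> integrable (lebesgue_on S) (\<lambda>x. (f x)\<^sup>2)"
  using assms by (simp add: L2_space_def set_integrable_iff_lebesgue_on)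

lemma L2_norm_eq:
  assumes "S \<in> sets lebesgue"
  shows "L2_norm S f = sqrt (integral\<^sup>L (lebesgue_on S) (\<lambda>x. (f x)\<^sup>2))"
  using assms by (simp add: L2_norm_def set_integral_eq_lebesgue_on)

lemma L2_norm_square:
  assumes "S \<in> sets lebesgue"
  shows "(L2_norm S f)\<^sup>2 = integral\<^sup>L (lebesgue_on S) (\<lambda>x. (f x)\<^sup>2)"
  using assms by (simp add: L2_norm_eq)

lemma L2_norm_nonneg [simp]: "S \<in> sets lebesgue \<Longrightarrow> 0 \<le> L2_norm S f"
  by (simp add: L2_norm_eq)

lemma L2_norm_cong_AE:
  assumes "S \<in> sets lebesgue" "f \<in> borel_measurable (lebesgue_on S)"
    "g \<in> borel_measurable (lebesgue_on S)" "AE x in lebesgue_on S. f x = g x"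
  shows "L2_norm S f = L2_norm S g"
  unfolding L2_norm_eq[OF assms(1)]
  by (intro arg_cong[where f = sqrt] integral_cong_AE) (use assms in auto)

lemma L2_mult_integrable:
  assumes S: "S \<in> sets lebesgue" and "f \<in> L2_space S" "g \<in> L2_space S"
  shows "integrable (lebesgue_on S) (\<lambda>x. f x * g x)"
proof (rule Bochner_Integration.integrable_bound)
  show "integrable (lebesgue_on S) (\<lambda>x. (f x)\<^sup>2 + (g x)\<^sup>2)"
    using assms by (simp add: L2_space_iff)
  show "(\<lambda>x. f x * g x) \<in> borel_measurable (lebesgue_on S)"
    using assms by (auto simp: L2_space_iff)
  have "\<bar>u * v\<bar> \<le> u\<^sup>2 + v\<^sup>2" for u v :: real
  proof -
    have "2 * (\<bar>u\<bar> * \<bar>v\<bar>) \<le> \<bar>u\<bar>\<^sup>2 + \<bar>v\<bar>\<^sup>2"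
      using sum_squares_bound[of "\<bar>u\<bar>" "\<bar>v\<bar>"] by (simp add: mult.assoc)
    moreover have "0 \<le> \<bar>u\<bar> * \<bar>v\<bar>" by simp
    ultimately show ?thesis unfolding abs_mult power2_abs by linarith
  qed
  then show "AE x in lebesgue_on S. norm (f x * g x) \<le> norm ((f x)\<^sup>2 + (g x)\<^sup>2)"
    by (auto intro!: AE_I2)
qed

lemma L2_cmult:
  assumes "S \<in> sets lebesgue" "f \<in> L2_space S"
  shows "(\<lambda>x. c * f x) \<in> L2_space S"
  using assms by (auto simp: L2_space_iff power_mult_distrib)

lemma L2_add:
  assumes S: "S \<in> sets lebesgue" and "f \<in> L2_space S" "g \<in> L2_space S"
  shows "(\<lambda>x. f x + g x) \<in> L2_space S"
proof -
  have "integrable (lebesgue_on S) (\<lambda>x. (f x)\<^sup>2 + (g x)\<^sup>2 + 2 * (f x * g x))"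
    using assms L2_mult_integrable[OF assms] by (simp add: L2_space_iff)
  then have "integrable (lebesgue_on S) (\<lambda>x. (f x + g x)\<^sup>2)"
    by (simp add: power2_sum mult.assoc)
  then show ?thesis using assms by (auto simp: L2_space_iff)
qed

lemma L2_diff:
  assumes S: "S \<in> sets lebesgue" and "f \<in> L2_space S" "g \<in> L2_space S"
  shows "(\<lambda>x. f x - g x) \<in> L2_space S"
  using L2_add[OF S assms(2) L2_cmult[OF S assms(3), of "-1"]] by simp

lemma L2_sum:
  assumes S: "S \<in> sets lebesgue" and "\<And>i. i \<in> I \<Longrightarrow> f i \<in> L2_space S"
  shows "(\<lambda>x. \<Sum>i\<in>I. f i x) \<in> L2_space S"
  using assms(2)
proof (induction I rule: infinite_finite_induct)
  case (insert i I)
  then show ?case using L2_add[OF S, of "f i" "\<lambda>x. \<Sum>i\<in>I. f i x"] by simp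
qed (use S in \<open>simp_all add: L2_space_iff\<close>)

lemma L2_norm_cmult:
  assumes "S \<in> sets lebesgue"
  shows "L2_norm S (\<lambda>x. c * f x) = \<bar>c\<bar> * L2_norm S f"
  using assms by (simp add: L2_norm_eq power_mult_distrib real_sqrt_mult)

lemma L2_norm_minus:
  assumes "S \<in> sets lebesgue"
  shows "L2_norm S (\<lambda>x. - f x) = L2_norm S f"
  using assms by (simp add: L2_norm_eq)

text \<open>
  The quadratic form \<open>\<integral> (s f - t g)\<^sup>2\<close> is nonnegative for all \<open>s\<close> and \<open>t\<close>; two choices of the pair
  \<open>(s, t)\<close> bound its mixed coefficient, according to whether \<open>\<integral> g\<^sup>2\<close> vanishes.
\<close>

lemma L2_Cauchy_Schwarz:
  assumes S: "S \<in> sets lebesgue" and f: "f \<in> L2_space S" and g: "g \<in> L2_space S"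
  shows "\<bar>integral\<^sup>L (lebesgue_on S) (\<lambda>x. f x * g x)\<bar> \<le> L2_norm S f * L2_norm S g"
proof -
  let ?I = "integral\<^sup>L (lebesgue_on S)"
  define A B C where "A = ?I (\<lambda>x. (f x)\<^sup>2)" and "B = ?I (\<lambda>x. f x * g x)" and "C = ?I (\<lambda>x. (g x)\<^sup>2)"
  have int: "integrable (lebesgue_on S) (\<lambda>x. (f x)\<^sup>2)" "integrable (lebesgue_on S) (\<lambda>x. (g x)\<^sup>2)"
    "integrable (lebesgue_on S) (\<lambda>x. f x * g x)"
    using f g L2_mult_integrable[OF S f g] by (simp_all add: L2_space_iff S)
  have quad: "0 \<le> s\<^sup>2 * A - 2 * s * t * B + t\<^sup>2 * C" for s t
  proof -
    have "0 \<le> ?I (\<lambda>x. (s * f x - t * g x)\<^sup>2)" by simp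
    also have "(\<lambda>x. (s * f x - t * g x)\<^sup>2)
        = (\<lambda>x. s\<^sup>2 * (f x)\<^sup>2 - (2 * s * t) * (f x * g x) + t\<^sup>2 * (g x)\<^sup>2)"
      by (auto simp: power2_eq_square algebra_simps)
    also have "?I \<dots> = s\<^sup>2 * A - 2 * s * t * B + t\<^sup>2 * C"
      unfolding A_def B_def C_def using int by simp
    finally show ?thesis .
  qed
  have "B\<^sup>2 \<le> A * C"
  proof (cases "C = 0")
    case True
    have "A \<ge> 0" unfolding A_def by simp
    \<comment> \<open>With \<open>C = 0\<close> the form is linear in \<open>t\<close>; \<open>t = A + 1\<close> is large enough to make it negative unless \<open>B = 0\<close>.\<close>
    have "0 \<le> B\<^sup>2 * A - 2 * B * ((A + 1) * B)"
      using quad[of B "A + 1"] True by (simp add: mult.assoc mult.commute mult.left_commute)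
    then have "0 \<le> B\<^sup>2 * (- A - 2)" by (simp add: power2_eq_square algebra_simps)
    then have "B\<^sup>2 \<le> 0" using \<open>A \<ge> 0\<close> by (simp add: zero_le_mult_iff)
    then show ?thesis using True by simp
  next
    case False
    then have "C > 0" unfolding C_def by (simp add: less_le)
    have "0 \<le> C * (A * C - B\<^sup>2)"
      using quad[of C B] by (simp add: power2_eq_square algebra_simps)
    then show ?thesis using \<open>C > 0\<close> by (simp add: zero_le_mult_iff)
  qed
  then have "sqrt (B\<^sup>2) \<le> sqrt (A * C)" by (rule real_sqrt_le_mono)
  then show ?thesis
    by (simp add: L2_norm_eq S A_def B_def C_def real_sqrt_mult)
qed

lemma L2_norm_triangle:
  assumes S: "S \<in> sets lebesgue" and f: "f \<in> L2_space S" and g: "g \<in> L2_space S"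
  shows "L2_norm S (\<lambda>x. f x + g x) \<le> L2_norm S f + L2_norm S g"
proof (rule power2_le_imp_le)
  let ?I = "integral\<^sup>L (lebesgue_on S)"
  have int: "integrable (lebesgue_on S) (\<lambda>x. (f x)\<^sup>2)" "integrable (lebesgue_on S) (\<lambda>x. (g x)\<^sup>2)"
    "integrable (lebesgue_on S) (\<lambda>x. f x * g x)"
    using f g L2_mult_integrable[OF S f g] by (simp_all add: L2_space_iff S)
  have "(L2_norm S (\<lambda>x. f x + g x))\<^sup>2 = ?I (\<lambda>x. (f x)\<^sup>2 + (g x)\<^sup>2 + 2 * (f x * g x))"
    by (simp add: L2_norm_square S power2_sum mult.assoc)
  also have "\<dots> = (L2_norm S f)\<^sup>2 + (L2_norm S g)\<^sup>2 + 2 * ?I (\<lambda>x. f x * g x)"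
    using int by (simp add: L2_norm_square S)
  also have "\<dots> \<le> (L2_norm S f)\<^sup>2 + (L2_norm S g)\<^sup>2 + 2 * (L2_norm S f * L2_norm S g)"
    using L2_Cauchy_Schwarz[OF S f g] by simp
  also have "\<dots> = (L2_norm S f + L2_norm S g)\<^sup>2" by (simp add: power2_sum)
  finally show "(L2_norm S (\<lambda>x. f x + g x))\<^sup>2 \<le> (L2_norm S f + L2_norm S g)\<^sup>2" .
qed (use S in simp)

lemma L2_norm_triangle_diff:
  assumes S: "S \<in> sets lebesgue" and f: "f \<in> L2_space S" and g: "g \<in> L2_space S"
  shows "L2_norm S (\<lambda>x. f x - g x) \<le> L2_norm S f + L2_norm S g"
  using L2_norm_triangle[OF S f L2_cmult[OF S g, of "-1"]] by (simp add: L2_norm_minus S)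

lemma L2_norm_sum:
  assumes S: "S \<in> sets lebesgue" and f: "\<And>i. i \<in> I \<Longrightarrow> f i \<in> L2_space S"
  shows "L2_norm S (\<lambda>x. \<Sum>i\<in>I. f i x) \<le> (\<Sum>i\<in>I. L2_norm S (f i))"
  using f
proof (induction I rule: infinite_finite_induct)
  case (insert i I)
  have "L2_norm S (\<lambda>x. f i x + (\<Sum>i\<in>I. f i x)) \<le> L2_norm S (f i) + L2_norm S (\<lambda>x. \<Sum>i\<in>I. f i x)"
    by (intro L2_norm_triangle S L2_sum insert.prems) auto
  also have "\<dots> \<le> L2_norm S (f i) + (\<Sum>i\<in>I. L2_norm S (f i))"
    using insert by simp
  finally show ?case using insert.hyps by simp
qed (use S in \<open>simp_all add: L2_norm_eq\<close>)

lemma L2_bounded: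
  assumes S: "S \<in> lmeasurable" and f: "f \<in> borel_measurable (lebesgue_on S)"
    and B: "0 \<le> B" "\<And>x. x \<in> S \<Longrightarrow> \<bar>f x\<bar> \<le> B"
  shows "f \<in> L2_space S" and "L2_norm S f \<le> B * sqrt (measure lebesgue S)"
proof -
  have S': "S \<in> sets lebesgue" using S by auto
  have const: "integrable (lebesgue_on S) (\<lambda>x. B\<^sup>2)"
    by (rule finite_measure.integrable_const[OF finite_measure_lebesgue_on[OF S]])
  have le: "(f x)\<^sup>2 \<le> B\<^sup>2" if "x \<in> S" for x
    using power_mono[OF B(2)[OF that], of 2] by simp
  have int: "integrable (lebesgue_on S) (\<lambda>x. (f x)\<^sup>2)"
    by (rule Bochner_Integration.integrable_bound[OF const]) (use f le in \<open>auto intro!: AE_I2\<close>)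
  then show "f \<in> L2_space S" using f by (simp add: L2_space_iff S')
  have "integral\<^sup>L (lebesgue_on S) (\<lambda>x. (f x)\<^sup>2) \<le> integral\<^sup>L (lebesgue_on S) (\<lambda>x. B\<^sup>2)"
    using le by (intro integral_mono int const) simp
  also have "\<dots> = B\<^sup>2 * measure lebesgue S"
    using S' by (simp add: measure_restrict_space)
  finally have "L2_norm S f \<le> sqrt (B\<^sup>2 * measure lebesgue S)"
    by (simp add: L2_norm_eq S')
  then show "L2_norm S f \<le> B * sqrt (measure lebesgue S)" using B by (simp add: real_sqrt_mult)
qed

text \<open>
  On a set of finite measure this is the Cauchy-Schwarz inequality against the constant 1; it gives
  the factor by which primitives and half-cell means are controlled.
\<close>

lemma L2_integrable:
  assumes S: "S \<in> lmeasurable" and f: "f \<in> L2_space S"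
  shows "integrable (lebesgue_on S) f"
    and "integral\<^sup>L (lebesgue_on S) (\<lambda>x. \<bar>f x\<bar>) \<le> sqrt (measure lebesgue S) * L2_norm S f"
proof -
  have S': "S \<in> sets lebesgue" using S by auto
  have one: "(\<lambda>x. 1) \<in> L2_space S" "L2_norm S (\<lambda>x. 1) \<le> sqrt (measure lebesgue S)"
    using L2_bounded[OF S, of "\<lambda>x. 1" 1] by simp_all
  show "integrable (lebesgue_on S) f" using L2_mult_integrable[OF S' one(1) f] by simp
  have abs: "(\<lambda>x. \<bar>f x\<bar>) \<in> L2_space S" "L2_norm S (\<lambda>x. \<bar>f x\<bar>) = L2_norm S f"
    using f by (auto simp: L2_space_iff L2_norm_eq S')
  have "integral\<^sup>L (lebesgue_on S) (\<lambda>x. \<bar>f x\<bar>) \<le> L2_norm S (\<lambda>x. 1) * L2_norm S f"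
    using L2_Cauchy_Schwarz[OF S' one(1) abs(1)] abs(2) by simp
  also have "\<dots> \<le> sqrt (measure lebesgue S) * L2_norm S f"
    by (intro mult_right_mono one) (use S' in simp)
  finally show "integral\<^sup>L (lebesgue_on S) (\<lambda>x. \<bar>f x\<bar>) \<le> sqrt (measure lebesgue S) * L2_norm S f" .
qed

section \<open>Smooth functions on the line\<close>

definition smooth :: "(real \<Rightarrow> real) \<Rightarrow> bool" where
  "smooth f \<longleftrightarrow> (\<forall>n x. (deriv ^^ n) f field_differentiable at x)"

text \<open>
  Proving smoothness through iterated derivatives directly would require closed formulas for them. It
  is enough to exhibit a class of functions that is closed under differentiation.
\<close>

lemma smooth_coinduct:
  assumes "P f" and step: "\<And>g. P g \<Longrightarrow> \<exists>h. P h \<and> (\<forall>x. (g has_field_derivative h x) (at x))"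
  shows "smooth f"
proof -
  have closed: "P (deriv g)" if g: "P g" for g
  proof -
    obtain h where h: "P h" "\<And>x. (g has_field_derivative h x) (at x)" using step[OF g] by blast
    then have "deriv g = h" by (auto intro: DERIV_imp_deriv)
    then show ?thesis using h by simp
  qed
  have "P ((deriv ^^ n) f)" for n by (induction n) (auto intro: assms(1) closed)
  then show ?thesis
    unfolding smooth_def field_differentiable_def by (meson step)
qed

lemma smooth_deriv: "smooth f \<Longrightarrow> smooth (deriv f)"
  unfolding smooth_def by (metis comp_apply funpow_Suc_right)

lemma smooth_DERIV: "smooth f \<Longrightarrow> (f has_field_derivative deriv f x) (at x)"
  unfolding smooth_def by (metis DERIV_deriv_iff_field_differentiable funpow_0)

lemma smooth_iterated_deriv: "smooth f \<Longrightarrow> smooth ((deriv ^^ n) f)"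
  by (induction n) (auto intro: smooth_deriv)

lemma smooth_continuous_on: "smooth f \<Longrightarrow> continuous_on S f"
  by (meson DERIV_isCont continuous_at_imp_continuous_on smooth_DERIV)

lemma smooth_antiderivative:
  assumes "\<And>x. (F has_field_derivative f x) (at x)" "smooth f"
  shows "smooth F"
  by (rule smooth_coinduct[where P = "\<lambda>h. h = F \<or> smooth h"])
     (use assms smooth_deriv smooth_DERIV in blast)+

lemma smooth_linear_combination:
  assumes "smooth u" "smooth v"
  shows "smooth (\<lambda>x. s * u x + t * v x)"
proof (rule smooth_coinduct[where P = "\<lambda>h. \<exists>u v. smooth u \<and> smooth v \<and> h = (\<lambda>x. s * u x + t * v x)"])
  fix g assume "\<exists>u v. smooth u \<and> smooth v \<and> g = (\<lambda>x. s * u x + t * v x)"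
  then obtain u v where *: "smooth u" "smooth v" "g = (\<lambda>x. s * u x + t * v x)" by blast
  then have "(g has_field_derivative s * deriv u x + t * deriv v x) (at x)" for x
    by (auto intro!: derivative_eq_intros smooth_DERIV)
  then show "\<exists>h. (\<exists>u v. smooth u \<and> smooth v \<and> h = (\<lambda>x. s * u x + t * v x)) \<and>
      (\<forall>x. (g has_field_derivative h x) (at x))"
    using *(1,2) smooth_deriv by (intro exI[of _ "\<lambda>x. s * deriv u x + t * deriv v x"]) blast
qed (use assms in blast)

lemma smooth_affine:
  assumes "smooth f"
  shows "smooth (\<lambda>x. f (s * x + t))"
proof (rule smooth_coinduct[where P = "\<lambda>h. \<exists>u c. smooth u \<and> h = (\<lambda>x. c * u (s * x + t))"])
  show "\<exists>u c. smooth u \<and> (\<lambda>x. f (s * x + t)) = (\<lambda>x. c * u (s * x + t))"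
    using assms by (intro exI[of _ f] exI[of _ 1]) simp
  fix g assume "\<exists>u c. smooth u \<and> g = (\<lambda>x. c * u (s * x + t))"
  then obtain u c where *: "smooth u" "g = (\<lambda>x. c * u (s * x + t))" by blast
  have "(g has_field_derivative (c * s) * deriv u (s * x + t)) (at x)" for x
    unfolding *(2)
    by (auto intro!: derivative_eq_intros DERIV_chain2[OF smooth_DERIV[OF *(1)]])
  then show "\<exists>h. (\<exists>u c. smooth u \<and> h = (\<lambda>x. c * u (s * x + t))) \<and>
      (\<forall>x. (g has_field_derivative h x) (at x))"
    using *(1) smooth_deriv by (intro exI[of _ "\<lambda>x. (c * s) * deriv u (s * x + t)"]) blast
qed

text \<open>
  Finite sums of products of smooth functions: by the product rule this class is closed under
  differentiation, which single products are not.
\<close>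

inductive smooth_product_sum :: "(real \<Rightarrow> real) \<Rightarrow> bool" where
  product: "smooth u \<Longrightarrow> smooth v \<Longrightarrow> smooth_product_sum (\<lambda>x. u x * v x)"
| sum: "smooth_product_sum f \<Longrightarrow> smooth_product_sum g \<Longrightarrow> smooth_product_sum (\<lambda>x. f x + g x)"

lemma smooth_mult:
  assumes "smooth f" "smooth g"
  shows "smooth (\<lambda>x. f x * g x)"
proof (rule smooth_coinduct[where P = smooth_product_sum])
  show "smooth_product_sum (\<lambda>x. f x * g x)" using assms by (rule product)
  fix h assume "smooth_product_sum h"
  then show "\<exists>h'. smooth_product_sum h' \<and> (\<forall>x. (h has_field_derivative h' x) (at x))"
  proof induction
    case (product u v)
    have "smooth_product_sum (\<lambda>x. deriv u x * v x + u x * deriv v x)"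
      using product by (intro smooth_product_sum.intros smooth_deriv)
    moreover have "((\<lambda>x. u x * v x) has_field_derivative deriv u x * v x + u x * deriv v x) (at x)" for x
      using product by (auto intro!: derivative_eq_intros smooth_DERIV)
    ultimately show ?case by blast
  next
    case (sum f g)
    then obtain f' g' where
      "smooth_product_sum f'" "\<And>x. (f has_field_derivative f' x) (at x)"
      "smooth_product_sum g'" "\<And>x. (g has_field_derivative g' x) (at x)" by blast
    then have "smooth_product_sum (\<lambda>x. f' x + g' x)"
      "\<And>x. ((\<lambda>x. f x + g x) has_field_derivative f' x + g' x) (at x)"
      by (auto intro!: derivative_eq_intros smooth_product_sum.intros)
    then show ?case by (intro exI[of _ "\<lambda>x. f' x + g' x"]) blast
  qed
qed

lemma deriv_linear_combination:
  assumes "smooth u" "smooth v"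
  shows "deriv (\<lambda>x. s * u x + t * v x) = (\<lambda>x. s * deriv u x + t * deriv v x)"
  using assms by (auto intro!: DERIV_imp_deriv derivative_eq_intros smooth_DERIV)

lemma iterated_deriv_linear_combination:
  assumes "smooth u" "smooth v"
  shows "(deriv ^^ n) (\<lambda>x. s * u x + t * v x) = (\<lambda>x. s * (deriv ^^ n) u x + t * (deriv ^^ n) v x)"
  using assms
  by (induction n) (auto simp: deriv_linear_combination smooth_iterated_deriv)

section \<open>Compactly supported bumps\<close>

text \<open>
  For \<open>p = 1\<close> this is the classical function that is flat at 0. The polynomial factor in \<open>1 / x\<close> is
  there because every derivative has again this form, with another polynomial.
\<close>

definition flat_exp :: "real poly \<Rightarrow> real \<Rightarrow> real" where
  "flat_exp p x = (if x > 0 then poly p (1 / x) * exp (- (1 / x)) else 0)"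

lemma poly_exp_decay: "((\<lambda>y::real. y ^ k * poly p y * exp (- y)) \<longlongrightarrow> 0) at_top"
proof (induction p arbitrary: k)
  case 0 then show ?case by simp
next
  case (pCons a p)
  have "((\<lambda>y::real. a * (y ^ k / exp y) + y ^ Suc k * poly p y * exp (- y)) \<longlongrightarrow> a * 0 + 0) at_top"
    by (intro tendsto_intros pCons tendsto_power_div_exp_0)
  then show ?case
    by (simp add: algebra_simps exp_minus divide_inverse)
qed

text \<open>
  Away from 0 this is calculus. At 0 the difference quotient from the right is
  \<open>y * poly p y * exp (- y)\<close> with \<open>y = 1 / x\<close>, which tends to 0.
\<close>

lemma flat_exp_DERIV:
  "(flat_exp p has_field_derivative flat_exp ([:0, 0, 1:] * (p - pderiv p)) x) (at x)"
proof -
  consider "x > 0" | "x < 0" | "x = 0" by linarith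
  then show ?thesis
  proof cases
    case 1
    have "((\<lambda>x. poly p (1 / x) * exp (- (1 / x))) has_field_derivative
        poly ([:0, 0, 1:] * (p - pderiv p)) (1 / x) * exp (- (1 / x))) (at x)"
      using 1 by (auto intro!: derivative_eq_intros DERIV_chain2[OF poly_DERIV]
          simp: power2_eq_square field_simps)
    moreover have "eventually (\<lambda>y. y > 0) (nhds x)" using 1 by (rule order_tendstoD(1)[OF filterlim_ident])
    ultimately show ?thesis
      using 1 by (subst DERIV_cong_ev[OF refl _ refl, where g = "\<lambda>x. poly p (1 / x) * exp (- (1 / x))"])
        (auto simp: flat_exp_def elim!: eventually_mono)
  next
    case 2
    have "eventually (\<lambda>y. y < 0) (nhds x)" using 2 by (rule order_tendstoD(2)[OF filterlim_ident])
    then show ?thesis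
      using 2 by (subst DERIV_cong_ev[OF refl _ refl, where g = "\<lambda>x. 0"])
        (auto simp: flat_exp_def elim!: eventually_mono)
  next
    case 3
    have "((\<lambda>y. (flat_exp p y - flat_exp p 0) / (y - 0)) \<longlongrightarrow> 0) (at 0)"
    proof (rule filterlim_split_at)
      have "((\<lambda>y::real. (1 / y) ^ 1 * poly p (1 / y) * exp (- (1 / y))) \<longlongrightarrow> 0) (at_right 0)"
        by (rule filterlim_compose[OF poly_exp_decay])
           (simp add: divide_inverse filterlim_inverse_at_top_right)
      then show "((\<lambda>y. (flat_exp p y - flat_exp p 0) / (y - 0)) \<longlongrightarrow> 0) (at_right 0)"
        by (rule Lim_transform_eventually)
           (auto simp: flat_exp_def eventually_at_filter field_simps)
      show "((\<lambda>y. (flat_exp p y - flat_exp p 0) / (y - 0)) \<longlongrightarrow> 0) (at_left 0)"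
        by (rule Lim_transform_eventually[OF tendsto_const])
           (auto simp: flat_exp_def eventually_at_filter)
    qed
    then show ?thesis
      using 3 by (simp add: has_field_derivative_iff flat_exp_def)
  qed
qed

lemma smooth_flat_exp: "smooth (flat_exp p)"
  by (rule smooth_coinduct[where P = "\<lambda>h. \<exists>p. h = flat_exp p"]) (use flat_exp_DERIV in blast)+

text \<open>
  As \<open>n\<close> grows these smooth functions increase to the indicator of the open interval from \<open>c\<close> to
  \<open>d\<close>, while vanishing outside it for every \<open>n\<close>.
\<close>

definition bump :: "real \<Rightarrow> real \<Rightarrow> nat \<Rightarrow> real \<Rightarrow> real" where
  "bump c d n x = flat_exp 1 (real n * x + - (real n * c)) * flat_exp 1 (- real n * x + real n * d)"

lemma smooth_bump: "smooth (bump c d n)"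
  unfolding bump_def by (intro smooth_mult smooth_affine smooth_flat_exp)

lemma bump_eq_0: "x \<notin> {c<..<d} \<Longrightarrow> bump c d n x = 0"
proof -
  assume "x \<notin> {c<..<d}"
  then have "real n * x \<le> real n * c \<or> real n * d \<le> real n * x"
    by (auto intro: mult_left_mono)
  then show ?thesis by (auto simp: bump_def flat_exp_def)
qed

lemma abs_bump_le_1: "\<bar>bump c d n x\<bar> \<le> 1"
proof -
  have "\<bar>flat_exp 1 y\<bar> \<le> 1" for y by (auto simp: flat_exp_def)
  then show ?thesis unfolding bump_def abs_mult by (intro mult_le_one) auto
qed

lemma bump_tendsto_1:
  assumes "x \<in> {c<..<d}"
  shows "(\<lambda>n. bump c d n x) \<longlonglongrightarrow> 1"
proof -
  have *: "(\<lambda>n. flat_exp 1 (real n * y)) \<longlonglongrightarrow> 1" if "y > 0" for y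
  proof -
    have "(\<lambda>n. exp (- ((1 / y) * (1 / real n)))) \<longlonglongrightarrow> exp (- ((1 / y) * 0))"
      by (intro tendsto_intros lim_1_over_n)
    then have "(\<lambda>n. exp (- (1 / (real n * y)))) \<longlonglongrightarrow> 1" by (simp add: mult.commute)
    then show ?thesis
      by (rule Lim_transform_eventually)
         (use that in \<open>auto simp: flat_exp_def eventually_sequentially intro!: exI[of _ 1]\<close>)
  qed
  have "(\<lambda>n. flat_exp 1 (real n * (x - c)) * flat_exp 1 (real n * (d - x))) \<longlonglongrightarrow> 1 * 1"
    using assms by (intro tendsto_mult *) auto
  then show ?thesis by (simp add: bump_def algebra_simps)
qed

section \<open>Functions with vanishing integrals\<close>

lemma sigma_finite_lebesgue: "sigma_finite_measure (lebesgue :: 'a::euclidean_space measure)"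
proof
  obtain A :: "'a set set" where "countable A" "A \<subseteq> sets lborel" "\<Union>A = space lborel"
      "\<forall>a\<in>A. emeasure lborel a \<noteq> \<infinity>"
    using lborel.sigma_finite_countable by blast
  then show "\<exists>A. countable A \<and> A \<subseteq> sets lebesgue \<and> \<Union>A = space (lebesgue :: 'a measure) \<and>
      (\<forall>a\<in>A. emeasure (lebesgue :: 'a measure) a \<noteq> \<infinity>)"
    by (intro exI[of _ A]) (auto simp: subset_iff)
qed

text \<open>
  The half-lines generate the Borel sets and are closed under intersection, so Dynkin's argument
  carries the vanishing of the integral to all Borel sets, hence to all Lebesgue sets; a function whose
  integral over every measurable set is 0 vanishes almost everywhere.
\<close>

lemma AE_zero_of_zero_integral_atMost:
  fixes h :: "real \<Rightarrow> real"
  assumes h: "integrable lebesgue h" and zero: "\<And>x. (LINT y:{..x}|lebesgue. h y) = 0"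
  shows "AE x in lebesgue. h x = 0"
proof (rule sigma_finite_measure.density_zero[OF _ h])
  show "sigma_finite_measure lebesgue" by (rule sigma_finite_lebesgue)
  have int: "set_integrable lebesgue A h" if "A \<in> sets lebesgue" for A
    using integrable_mult_indicator[OF that h] by (simp add: set_integrable_def)
  \<comment> \<open>The whole line is not a half-line; closure under complements needs its integral separately.\<close>
  have total: "integral\<^sup>L lebesgue h = 0"
  proof -
    have "(\<lambda>n. LINT y:{..real n}|lebesgue. h y) \<longlonglongrightarrow> (LINT y:(\<Union>n. {..real n})|lebesgue. h y)"
    proof (rule set_integral_cont_up)
      show "set_integrable lebesgue (\<Union>n. {..real n}) h" by (rule int) auto
    qed (auto simp: incseq_def)
    moreover have "(\<Union>n. {..real n}) = UNIV" by (auto simp: real_arch_simple)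
    ultimately have "(\<lambda>n. 0) \<longlonglongrightarrow> (LINT y:UNIV|lebesgue. h y)" by (simp add: zero)
    then show ?thesis by (simp add: LIMSEQ_const_iff set_lebesgue_integral_def)
  qed
  have borel: "(LINT y:A|lebesgue. h y) = 0" if "A \<in> sets borel" for A :: "real set"
  proof -
    have borel: "sigma_sets UNIV (range (\<lambda>a::real. {..a})) = sets borel"
      by (simp add: borel_eq_atMost)
    have "Int_stable (range (\<lambda>a::real. {..a}))" by (auto simp: Int_stable_def)
    moreover have "range (\<lambda>a::real. {..a}) \<subseteq> Pow UNIV" by simp
    moreover have "A \<in> sigma_sets UNIV (range (\<lambda>a::real. {..a}))" using that borel by simp
    ultimately show ?thesis
    proof (induction rule: sigma_sets_induct_disjoint)
      case (compl A)
      then have A: "A \<in> sets lebesgue" unfolding borel by auto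
      have "(LINT y:UNIV - A|lebesgue. h y) = (LINT y:UNIV|lebesgue. h y) - (LINT y:A|lebesgue. h y)"
        using set_integral_Un[of A "UNIV - A" lebesgue h] int[OF A] int[of "- A"] Compl_in_sets_lebesgue[of A] A by (simp add: Compl_eq_Diff_UNIV[symmetric])
      then show ?case using compl total by (simp add: set_lebesgue_integral_def)
    next
      case (union A)
      then have A: "A i \<in> sets lebesgue" for i unfolding borel by (auto simp: image_subset_iff)
      have "(LINT y:(\<Union>i. A i)|lebesgue. h y) = (\<Sum>i. (LINT y:A i|lebesgue. h y))"
        by (rule lebesgue_integral_countable_add)
           (use A int union in \<open>auto simp: disjoint_family_on_def\<close>)
      then show ?case using union by simp
    qed (use zero in \<open>auto simp: set_lebesgue_integral_def\<close>)
  qed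
  fix A :: "real set" assume "A \<in> sets lebesgue"
  then obtain B N where BN: "B \<in> sets borel" "negligible N" "B \<union> N = A"
    using sets_lebesgue_almost_borel by metis
  have sets: "A \<in> sets lebesgue" "B \<in> sets lebesgue" using \<open>A \<in> sets lebesgue\<close> \<open>B \<in> sets borel\<close> by auto
  have "AE x in lebesgue. x \<notin> N"
    using \<open>negligible N\<close> by (simp add: negligible_iff_null_sets AE_not_in)
  then have "AE x in lebesgue. indicator A x *\<^sub>R h x = indicator B x *\<^sub>R h x"
    by eventually_elim (use \<open>B \<union> N = A\<close> in \<open>auto simp: indicator_def\<close>)
  then have "(LINT y:A|lebesgue. h y) = (LINT y:B|lebesgue. h y)"
    using int[OF sets(1)] int[OF sets(2)]
    unfolding set_lebesgue_integral_def set_integrable_def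
    by (intro integral_cong_AE) auto
  then show "(LINT y:A|lebesgue. h y) = 0" using borel \<open>B \<in> sets borel\<close> by simp
qed

section \<open>Test functions and the fundamental lemma\<close>

lemma test_functions_Ioo:
  assumes "a < b"
  shows "\<phi> \<in> test_functions {a<..<b} \<longleftrightarrow>
    smooth \<phi> \<and> (\<exists>c d. a < c \<and> c < d \<and> d < b \<and> (\<forall>x. x \<notin> {c..d} \<longrightarrow> \<phi> x = 0))" (is "?L \<longleftrightarrow> ?R")
proof
  assume ?L
  then obtain K where K: "compact K" "K \<subseteq> {a<..<b}" "\<And>x. x \<notin> K \<Longrightarrow> \<phi> x = 0" and "smooth \<phi>"
    unfolding test_functions_def smooth_def by blast
  have "\<exists>c d. a < c \<and> c < d \<and> d < b \<and> K \<subseteq> {c..d}"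
  proof (cases "K = {}")
    case True
    show ?thesis using \<open>a < b\<close> True
      by (intro exI[of _ "(2 * a + b) / 3"] exI[of _ "(a + 2 * b) / 3"]) auto
  next
    case False
    obtain l u where lu: "l \<in> K" "u \<in> K" "\<And>x. x \<in> K \<Longrightarrow> l \<le> x \<and> x \<le> u"
      using compact_attains_inf[OF K(1) False] compact_attains_sup[OF K(1) False] by blast
    have "a < l" "u < b" "l \<le> u" using lu K(2) by auto
    then show ?thesis using lu
      by (intro exI[of _ "(a + l) / 2"] exI[of _ "(u + b) / 2"]) force
  qed
  then show ?R using K(3) \<open>smooth \<phi>\<close> by blast
next
  assume ?R
  then obtain c d where "smooth \<phi>" "a < c" "d < b" "\<forall>x. x \<notin> {c..d} \<longrightarrow> \<phi> x = 0" by blast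
  then show ?L unfolding test_functions_def smooth_def
    by (auto intro!: exI[of _ "{c..d}"])
qed

lemma test_function_smooth: "\<phi> \<in> test_functions S \<Longrightarrow> smooth \<phi>"
  by (simp add: test_functions_def smooth_def)

lemma test_function_deriv:
  assumes "a < b" "\<phi> \<in> test_functions {a<..<b}"
  shows "deriv \<phi> \<in> test_functions {a<..<b}"
proof -
  obtain c d where *: "smooth \<phi>" "a < c" "c < d" "d < b" "\<And>x. x \<notin> {c..d} \<Longrightarrow> \<phi> x = 0"
    using assms by (auto simp: test_functions_Ioo)
  have "deriv \<phi> x = 0" if "x \<notin> {c..d}" for x
  proof -
    have "((\<lambda>x. 0) has_field_derivative 0) (at x)" by simp
    then have "(\<phi> has_field_derivative 0) (at x)"
      by (rule has_field_derivative_transform_within_open[of _ _ _ "- {c..d}"])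
         (use that *(5) in auto)
    then show ?thesis by (rule DERIV_imp_deriv)
  qed
  then show ?thesis using * assms(1) smooth_deriv by (auto simp: test_functions_Ioo)
qed

lemma test_function_iterated_deriv:
  assumes "a < b" "\<phi> \<in> test_functions {a<..<b}"
  shows "(deriv ^^ n) \<phi> \<in> test_functions {a<..<b}"
  by (induction n) (use assms test_function_deriv in auto)

lemma test_function_linear_combination:
  assumes "a < b" "u \<in> test_functions {a<..<b}" "v \<in> test_functions {a<..<b}"
  shows "(\<lambda>x. s * u x + t * v x) \<in> test_functions {a<..<b}"
proof -
  obtain c d where *: "a < c" "c < d" "d < b" "\<And>x. x \<notin> {c..d} \<Longrightarrow> u x = 0"
    using assms by (auto simp: test_functions_Ioo)
  obtain c' d' where **: "a < c'" "c' < d'" "d' < b" "\<And>x. x \<notin> {c'..d'} \<Longrightarrow> v x = 0"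
    using assms by (auto simp: test_functions_Ioo)
  have "smooth (\<lambda>x. s * u x + t * v x)"
    using assms test_function_smooth smooth_linear_combination by blast
  moreover have "\<forall>x. x \<notin> {min c c'..max d d'} \<longrightarrow> s * u x + t * v x = 0"
    using *(4) **(4) by (metis add_0 atLeastAtMost_iff max.coboundedI1 max.coboundedI2 min.coboundedI1 min.coboundedI2 mult_zero_right)
  moreover have "a < min c c'" "min c c' < max d d'" "max d d' < b" using * ** by auto
  ultimately show ?thesis using assms(1) by (subst test_functions_Ioo) blast+
qed

lemma bump_test_function:
  assumes "a < c" "c < d" "d < b"
  shows "bump c d n \<in> test_functions {a<..<b}"
proof -
  have "\<forall>x. x \<notin> {c..d} \<longrightarrow> bump c d n x = 0" using bump_eq_0 by auto
  then show ?thesis using assms smooth_bump by (subst test_functions_Ioo) auto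
qed

lemma test_function_bounded:
  assumes "\<phi> \<in> test_functions S"
  obtains B where "0 \<le> B" "\<And>x. \<bar>\<phi> x\<bar> \<le> B"
proof -
  obtain K where K: "compact K" "\<And>x. x \<notin> K \<Longrightarrow> \<phi> x = 0"
    using assms by (auto simp: test_functions_def)
  have "compact (\<phi> ` K)"
    using K(1) test_function_smooth[OF assms] by (intro compact_continuous_image smooth_continuous_on)
  then obtain B where B: "\<And>x. x \<in> K \<Longrightarrow> \<bar>\<phi> x\<bar> \<le> B"
    by (force dest!: compact_imp_bounded simp: bounded_iff)
  have "\<bar>\<phi> x\<bar> \<le> max 0 B" for x by (cases "x \<in> K") (use B K in \<open>auto simp: le_max_iff_disj\<close>)
  then show ?thesis by (intro that[of "max 0 B"]) auto
qed

lemma continuous_measurable_lebesgue_on: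
  fixes f :: "real \<Rightarrow> real"
  assumes "continuous_on UNIV f"
  shows "f \<in> borel_measurable (lebesgue_on S)"
  using borel_measurable_continuous_onI[OF assms]
  by (intro measurable_restrict_space1 measurable_completion) simp

lemma test_function_measurable:
  "\<phi> \<in> test_functions T \<Longrightarrow> \<phi> \<in> borel_measurable (lebesgue_on S)"
  by (intro continuous_measurable_lebesgue_on smooth_continuous_on test_function_smooth)

lemma test_function_L2:
  assumes "\<phi> \<in> test_functions T" "S \<in> lmeasurable"
  shows "\<phi> \<in> L2_space S"
proof -
  obtain B where "0 \<le> B" "\<And>x. \<bar>\<phi> x\<bar> \<le> B" using test_function_bounded[OF assms(1)] by blast
  then show ?thesis by (intro L2_bounded(1)[OF assms(2) test_function_measurable[OF assms(1)]])
qed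

lemma locally_integrable_on_Icc:
  assumes "locally_integrable_on h {a<..<b}" "a < c" "d < b"
  shows "integrable lebesgue (\<lambda>x. indicator {c..d} x * h x)"
proof -
  have "{c..d} \<subseteq> {a<..<b}" using assms(2,3) by auto
  then show ?thesis using assms(1) by (auto simp: locally_integrable_on_def set_integrable_def)
qed

lemma integrable_mult_test_function:
  fixes h :: "real \<Rightarrow> real"
  assumes "a < b" and h: "locally_integrable_on h {a<..<b}" and \<phi>: "\<phi> \<in> test_functions {a<..<b}"
  shows "integrable (lebesgue_on {a<..<b}) (\<lambda>x. h x * \<phi> x)"
proof -
  obtain c d where *: "a < c" "c < d" "d < b" "\<And>x. x \<notin> {c..d} \<Longrightarrow> \<phi> x = 0"
    using assms by (auto simp: test_functions_Ioo)
  obtain B where B: "0 \<le> B" "\<And>x. \<bar>\<phi> x\<bar> \<le> B" using test_function_bounded[OF \<phi>] by blast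
  have h': "integrable lebesgue (\<lambda>x. indicator {c..d} x * h x)"
    using locally_integrable_on_Icc[OF h] * by blast
  have "\<phi> \<in> borel_measurable lebesgue"
    using test_function_measurable[OF \<phi>, of UNIV] by (simp add: lebesgue_on_UNIV_eq)
  have "integrable lebesgue (\<lambda>x. (indicator {c..d} x * h x) * \<phi> x)"
  proof (rule Bochner_Integration.integrable_bound)
    show "integrable lebesgue (\<lambda>x. B * (indicator {c..d} x * h x))" using h' by simp
    show "(\<lambda>x. (indicator {c..d} x * h x) * \<phi> x) \<in> borel_measurable lebesgue"
      by (rule borel_measurable_times[OF borel_measurable_integrable[OF h'] \<open>\<phi> \<in> borel_measurable lebesgue\<close>])
    show "AE x in lebesgue. norm ((indicator {c..d} x * h x) * \<phi> x) \<le> norm (B * (indicator {c..d} x * h x))"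
      using B by (auto simp: abs_mult mult.commute intro!: AE_I2 mult_right_mono mult_left_mono)
  qed
  also have "(\<lambda>x. (indicator {c..d} x * h x) * \<phi> x) = (\<lambda>x. indicator {a<..<b} x *\<^sub>R (h x * \<phi> x))"
    using * by (auto simp: indicator_def fun_eq_iff)
  finally show ?thesis by (simp add: integrable_restrict_space)
qed

text \<open>
  The fundamental lemma of the calculus of variations. Bumps converge boundedly to indicators of
  intervals, so by dominated convergence \<open>h\<close> has integral 0 over every interval compactly contained in
  the domain; such intervals exhaust the domain.
\<close>

lemma AE_zero_if_integral_test_functions_zero:
  fixes h :: "real \<Rightarrow> real"
  assumes "a < b" and h: "locally_integrable_on h {a<..<b}"
    and zero: "\<And>\<phi>. \<phi> \<in> test_functions {a<..<b} \<Longrightarrow> (\<integral>x. h x * \<phi> x \<partial>lebesgue_on {a<..<b}) = 0"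
  shows "AE x in lebesgue_on {a<..<b}. h x = 0"
proof -
  have int: "integrable lebesgue (\<lambda>x. indicator {c..d} x * h x)" if "a < c" "d < b" for c d
    using locally_integrable_on_Icc[OF h] that by blast
  have int0: "(\<integral>x. indicator {c<..<d} x * h x \<partial>lebesgue) = 0" if cd: "a < c" "c < d" "d < b" for c d
  proof -
    have "(\<lambda>n. \<integral>x. (indicator {c..d} x * h x) * bump c d n x \<partial>lebesgue) \<longlonglongrightarrow>
        (\<integral>x. (indicator {c..d} x * h x) * indicator {c<..<d} x \<partial>lebesgue)"
    proof (rule integral_dominated_convergence)
      show "integrable lebesgue (\<lambda>x. \<bar>indicator {c..d} x * h x\<bar>)" using int[OF cd(1,3)] by simp
      have bm: "(\<lambda>x. indicator {c..d} x * h x) \<in> borel_measurable lebesgue" using int[OF cd(1,3)] by auto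
      show "(\<lambda>x. (indicator {c..d} x * h x) * indicator {c<..<d} x) \<in> borel_measurable lebesgue"
        by (rule borel_measurable_times[OF bm]) (intro borel_measurable_indicator, simp)
      show "(\<lambda>x. (indicator {c..d} x * h x) * bump c d n x) \<in> borel_measurable lebesgue" for n
        using test_function_measurable[OF bump_test_function[OF cd], of n UNIV]
        by (intro borel_measurable_times[OF bm]) (simp add: lebesgue_on_UNIV_eq)
      have "(\<lambda>n. bump c d n x) \<longlonglongrightarrow> indicator {c<..<d} x" for x
        using bump_tendsto_1[of x c d] bump_eq_0[of x c d] by (cases "x \<in> {c<..<d}") auto
      then show "AE x in lebesgue. (\<lambda>n. (indicator {c..d} x * h x) * bump c d n x) \<longlonglongrightarrow>
          (indicator {c..d} x * h x) * indicator {c<..<d} x"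
        by (intro AE_I2 tendsto_mult tendsto_const)
      show "AE x in lebesgue. norm ((indicator {c..d} x * h x) * bump c d n x) \<le> \<bar>indicator {c..d} x * h x\<bar>" for n
        using abs_bump_le_1[of c d n] by (intro AE_I2) (simp add: abs_mult mult_left_le)
    qed
    moreover have "(\<integral>x. (indicator {c..d} x * h x) * bump c d n x \<partial>lebesgue) = 0" for n
    proof -
      have "(\<lambda>x. (indicator {c..d} x * h x) * bump c d n x) = (\<lambda>x. indicator {a<..<b} x *\<^sub>R (h x * bump c d n x))"
      proof
        fix x show "(indicator {c..d} x * h x) * bump c d n x = indicator {a<..<b} x *\<^sub>R (h x * bump c d n x)"
          using cd bump_eq_0[of x c d n] by (cases "x \<in> {c<..<d}") auto
      qed
      then show ?thesis
        using zero[OF bump_test_function[OF cd], of n] by (simp add: integral_restrict_space)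
    qed
    moreover have "(\<lambda>x. (indicator {c..d} x * h x) * indicator {c<..<d} x) = (\<lambda>x. indicator {c<..<d} x * h x)"
      by (auto simp: indicator_def fun_eq_iff)
    ultimately show ?thesis by (simp add: LIMSEQ_const_iff)
  qed
  have AE: "AE x in lebesgue. x \<in> {c<..<d} \<longrightarrow> h x = 0" if cd: "a < c" "d < b" for c d
  proof -
    have "AE x in lebesgue. indicator {c<..<d} x * h x = 0"
    proof (rule AE_zero_of_zero_integral_atMost)
      have "integrable lebesgue (\<lambda>x. indicator {c<..<d} x *\<^sub>R (indicator {c..d} x * h x))"
        by (intro integrable_mult_indicator int cd) auto
      also have "(\<lambda>x. indicator {c<..<d} x *\<^sub>R (indicator {c..d} x * h x)) = (\<lambda>x. indicator {c<..<d} x * h x)"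
        by (auto simp: indicator_def fun_eq_iff)
      finally show "integrable lebesgue (\<lambda>x. indicator {c<..<d} x * h x)" .
      fix x :: real
      have meas: "(\<lambda>y. indicator A y * (indicator {c..d} y * h y)) \<in> borel_measurable lebesgue"
        if "A \<in> sets borel" for A
        using integrable_mult_indicator[OF _ int[OF cd], of A] that by auto
      have "AE y in lebesgue. y \<noteq> x" by (simp add: AE_completion AE_lborel_singleton)
      then have "AE y in lebesgue. indicator ({..x} \<inter> {c<..<d}) y * (indicator {c..d} y * h y)
          = indicator {c<..<min x d} y * (indicator {c..d} y * h y)"
        by eventually_elim (auto simp: indicator_def)
      then have "(\<integral>y. indicator ({..x} \<inter> {c<..<d}) y * (indicator {c..d} y * h y) \<partial>lebesgue)
          = (\<integral>y. indicator {c<..<min x d} y * (indicator {c..d} y * h y) \<partial>lebesgue)"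
        by (intro integral_cong_AE meas) auto
      moreover have "indicator ({..x} \<inter> {c<..<d}) y * (indicator {c..d} y * h y)
          = indicator {..x} y *\<^sub>R (indicator {c<..<d} y * h y)"
        "indicator {c<..<min x d} y * (indicator {c..d} y * h y) = indicator {c<..<min x d} y * h y" for y
        by (auto simp: indicator_def)
      ultimately have "(LINT y:{..x}|lebesgue. indicator {c<..<d} y * h y)
          = (\<integral>y. indicator {c<..<min x d} y * h y \<partial>lebesgue)"
        by (simp add: set_lebesgue_integral_def)
      also have "\<dots> = 0"
        by (cases "c < min x d") (use int0 cd in auto)
      finally show "(LINT y:{..x}|lebesgue. indicator {c<..<d} y * h y) = 0" .
    qed
    then show ?thesis by eventually_elim (auto simp: indicator_def)
  qed
  define e where "e n = (b - a) / (real n + 2)" for n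
  have "AE x in lebesgue. \<forall>n. x \<in> {a + e n<..<b - e n} \<longrightarrow> h x = 0"
    unfolding AE_all_countable e_def using \<open>a < b\<close> by (intro allI AE) auto
  then have "AE x in lebesgue. x \<in> {a<..<b} \<longrightarrow> h x = 0"
  proof eventually_elim
    case (elim x)
    show ?case
    proof
      assume x: "x \<in> {a<..<b}"
      define r where "r = min (x - a) (b - x)"
      have "r > 0" using x by (simp add: r_def)
      obtain n where "(b - a) / r < real n" using reals_Archimedean2 by blast
      then have "b - a < r * (real n + 2)"
        using \<open>r > 0\<close> by (simp add: divide_less_eq algebra_simps)
      then have "e n < r" by (simp add: e_def divide_less_eq add_pos_pos)
      then have "e n < x - a" "e n < b - x" by (simp_all add: r_def)
      then show "h x = 0" using elim[rule_format, of n] by auto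
    qed
  qed
  then show ?thesis by (simp add: AE_restrict_space_iff)
qed

section \<open>Integration against test functions\<close>

lemma integral_Ioo_FTC:
  fixes F f :: "real \<Rightarrow> real"
  assumes "c \<le> d" and F: "\<And>x. (F has_field_derivative f x) (at x)" and f: "continuous_on UNIV f"
  shows "integrable (lebesgue_on {c<..<d}) f"
    and "integral\<^sup>L (lebesgue_on {c<..<d}) f = F d - F c"
proof -
  have "set_integrable lebesgue {c..d} f"
    by (intro absolutely_integrable_continuous_real continuous_on_subset[OF f]) simp
  then have "set_integrable lebesgue {c<..<d} f"
    by (rule set_integrable_subset) auto
  then show int: "integrable (lebesgue_on {c<..<d}) f" by (simp add: set_integrable_iff_lebesgue_on)
  have "(f has_integral (F d - F c)) {c..d}"
    by (intro fundamental_theorem_of_calculus \<open>c \<le> d\<close>)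
       (metis F has_field_derivative_at_within has_real_derivative_iff_has_vector_derivative)
  then have "integral {c<..<d} f = F d - F c"
    by (simp add: has_integral_Icc_iff_Ioo integral_unique)
  then show "integral\<^sup>L (lebesgue_on {c<..<d}) f = F d - F c"
    using lebesgue_integral_eq_integral[OF int] by simp
qed

lemma poly_L2: "poly p \<in> L2_space {a<..<b::real}"
proof -
  have "bounded (poly p ` {a..b})"
    by (intro compact_imp_bounded compact_continuous_image continuous_intros) auto
  then obtain B where B: "\<And>x. x \<in> {a..b} \<Longrightarrow> \<bar>poly p x\<bar> \<le> B"
    by (force simp: bounded_iff)
  show ?thesis
  proof (rule L2_bounded(1))
    show "poly p \<in> borel_measurable (lebesgue_on {a<..<b})"
      by (intro continuous_measurable_lebesgue_on continuous_intros)
    show "\<bar>poly p x\<bar> \<le> max 0 B" if "x \<in> {a<..<b}" for x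
      using B[of x] that by auto
  qed auto
qed

lemma test_function_endpoints:
  assumes "a < b" "\<phi> \<in> test_functions {a<..<b}"
  shows "\<phi> a = 0" "\<phi> b = 0"
  using assms by (auto simp: test_functions_Ioo)

lemma L2_imp_locally_integrable:
  assumes "f \<in> L2_space {a<..<b::real}"
  shows "locally_integrable_on f {a<..<b}"
proof -
  have "set_integrable lebesgue {a<..<b} f"
    using L2_integrable(1)[OF _ assms] by (simp add: set_integrable_iff_lebesgue_on)
  then show ?thesis
    by (auto simp: locally_integrable_on_def
        intro!: set_integrable_subset[of lebesgue "{a<..<b}" f] dest: lmeasurable_compact)
qed

lemma AE_eq_if_same_test_integrals:
  assumes "a < b" and f: "locally_integrable_on f {a<..<b}" and g: "locally_integrable_on g {a<..<b}"
    and eq: "\<And>\<phi>. \<phi> \<in> test_functions {a<..<b} \<Longrightarrow>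
      (\<integral>x. f x * \<phi> x \<partial>lebesgue_on {a<..<b}) = (\<integral>x. g x * \<phi> x \<partial>lebesgue_on {a<..<b})"
  shows "AE x in lebesgue_on {a<..<b}. f x = g x"
proof -
  have "AE x in lebesgue_on {a<..<b}. f x - g x = 0"
  proof (rule AE_zero_if_integral_test_functions_zero[OF assms(1)])
    show "locally_integrable_on (\<lambda>x. f x - g x) {a<..<b}"
      using f g by (auto simp: locally_integrable_on_def)
    show "(\<integral>x. (f x - g x) * \<phi> x \<partial>lebesgue_on {a<..<b}) = 0"
      if \<phi>: "\<phi> \<in> test_functions {a<..<b}" for \<phi>
      using integrable_mult_test_function[OF assms(1) f \<phi>] integrable_mult_test_function[OF assms(1) g \<phi>] eq[OF \<phi>]
      by (simp add: left_diff_distrib)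
  qed
  then show ?thesis by eventually_elim simp
qed

text \<open>
  The mean-zero condition is exactly what makes the antiderivative starting from 0 on the left return
  to 0 on the right, so that its support stays compact.
\<close>

lemma test_function_antiderivative:
  assumes "a < b" and \<psi>: "\<psi> \<in> test_functions {a<..<b}"
    and zero: "integral\<^sup>L (lebesgue_on {a<..<b}) \<psi> = 0"
  shows "\<exists>\<phi>\<in>test_functions {a<..<b}. deriv \<phi> = \<psi>"
proof -
  obtain c d where cd: "a < c" "c < d" "d < b" "\<And>x. x \<notin> {c..d} \<Longrightarrow> \<psi> x = 0"
    using assms(1,2) by (auto simp: test_functions_Ioo)
  have cont: "continuous_on UNIV \<psi>" using \<psi> by (intro smooth_continuous_on test_function_smooth)
  have "\<exists>F. \<forall>x::real. - \<infinity> < ereal x \<longrightarrow> ereal x < \<infinity> \<longrightarrow> (F has_vector_derivative \<psi> x) (at x)"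
    using cont by (intro einterval_antiderivative) (auto simp: continuous_on_eq_continuous_at)
  then obtain F where F: "\<And>x. (F has_field_derivative \<psi> x) (at x)"
    by (auto simp: has_real_derivative_iff_has_vector_derivative)
  define \<phi> where "\<phi> x = F x - F a" for x
  have D: "(\<phi> has_field_derivative \<psi> x) (at x)" for x
    unfolding \<phi>_def by (auto intro!: derivative_eq_intros F)
  have "\<phi> b = \<phi> a"
    using integral_Ioo_FTC(2)[OF _ D cont, of a b] zero \<open>a < b\<close> by simp
  then have ab: "\<phi> a = 0" "\<phi> b = 0" by (simp_all add: \<phi>_def)
  have const: "\<phi> y = \<phi> x" if "x \<le> y" "\<And>z. z \<in> {x<..<y} \<Longrightarrow> \<psi> z = 0" for x y
  proof (cases "x = y")
    case False
    then have "x < y" using that by simp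
    have "continuous_on {x..y} \<phi>"
      by (meson D DERIV_isCont continuous_at_imp_continuous_on)
    moreover have "(\<phi> has_field_derivative 0) (at z)" if "x < z" "z < y" for z
      using D[of z] \<open>\<And>z. z \<in> {x<..<y} \<Longrightarrow> \<psi> z = 0\<close>[of z] that by simp
    ultimately show ?thesis using DERIV_isconst_end[OF \<open>x < y\<close>] by blast
  qed simp
  have "\<phi> x = 0" if x: "x \<notin> {c..d}" for x
  proof -
    consider "x \<le> a" | "a \<le> x" "x < c" | "x > d" "x \<le> b" | "x \<ge> b" using x by (metis atLeastAtMost_iff linorder_le_cases not_le)
    then show ?thesis
    proof cases
      case 1 then show ?thesis using const[of x a] cd ab by force
    next
      case 2 then show ?thesis using const[of a x] cd ab by force
    next
      case 3 then show ?thesis using const[of x b] cd ab by force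
    next
      case 4 then show ?thesis using const[of b x] cd ab by force
    qed
  qed
  moreover have "smooth \<phi>" using D \<psi> test_function_smooth smooth_antiderivative by blast
  ultimately have "\<phi> \<in> test_functions {a<..<b}"
    using cd \<open>a < b\<close> by (auto simp: test_functions_Ioo)
  moreover have "deriv \<phi> = \<psi>" using D by (auto intro: DERIV_imp_deriv)
  ultimately show ?thesis by blast
qed

text \<open>
  If all test functions had mean zero, the fundamental lemma would make the constant 1 vanish almost
  everywhere.
\<close>

lemma normalised_test_function:
  assumes "a < b"
  obtains \<eta> where "\<eta> \<in> test_functions {a<..<b}" "integral\<^sup>L (lebesgue_on {a<..<b}) \<eta> = 1"
proof -
  have "\<exists>\<phi>\<in>test_functions {a<..<b}. integral\<^sup>L (lebesgue_on {a<..<b}) \<phi> \<noteq> 0"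
  proof (rule ccontr)
    assume "\<not> ?thesis"
    moreover have "(\<lambda>x. 1) \<in> L2_space {a<..<b}"
      using L2_bounded(1)[of "{a<..<b}" "\<lambda>x. 1" 1] by simp
    ultimately have "AE x in lebesgue_on {a<..<b}. (1::real) = 0"
      by (intro AE_zero_if_integral_test_functions_zero[OF assms] L2_imp_locally_integrable) auto
    then have "emeasure (lebesgue_on {a<..<b}) {a<..<b} = 0"
      by (subst (asm) AE_iff_measurable[of "{a<..<b}"]) auto
    then show False using assms by (simp add: emeasure_restrict_space)
  qed
  then obtain \<phi> where \<phi>: "\<phi> \<in> test_functions {a<..<b}" "integral\<^sup>L (lebesgue_on {a<..<b}) \<phi> \<noteq> 0"
    by blast
  show ?thesis
  proof (rule that)
    show "(\<lambda>x. (1 / integral\<^sup>L (lebesgue_on {a<..<b}) \<phi>) * \<phi> x + 0 * \<phi> x) \<in> test_functions {a<..<b}"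
      using \<phi> assms by (intro test_function_linear_combination)
  qed (use \<phi>(2) in simp)
qed

section \<open>Primitives of integrable functions\<close>

text \<open>
  The function \<open>x \<mapsto> \<integral>\<^sub>a\<^sup>x g\<close>, written with a kernel over a fixed measure space so that measurability
  and the exchange of integrals are instances of the product measure theory.
\<close>

definition primitive :: "real \<Rightarrow> real \<Rightarrow> (real \<Rightarrow> real) \<Rightarrow> real \<Rightarrow> real" where
  "primitive a b g x = (\<integral>t. (if t < x then g t else 0) \<partial>lebesgue_on {a<..<b})"

lemma sigma_finite_lebesgue_on_Ioo: "sigma_finite_measure (lebesgue_on {a<..<b::real})"
  by (rule finite_measure.axioms(1)[OF finite_measure_lebesgue_on]) simp

lemma ident_measurable_lebesgue_on [measurable]: "(\<lambda>x::real. x) \<in> borel_measurable (lebesgue_on S)"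
  by (intro continuous_measurable_lebesgue_on continuous_intros)

lemma primitive_measurable:
  assumes [measurable]: "g \<in> borel_measurable (lebesgue_on {a<..<b})"
  shows "primitive a b g \<in> borel_measurable (lebesgue_on {a<..<b})"
proof -
  interpret sigma_finite_measure "lebesgue_on {a<..<b}" by (rule sigma_finite_lebesgue_on_Ioo)
  show ?thesis unfolding primitive_def by measurable
qed

text \<open>
  Each value of the primitive is at most the \<open>L\<^sup>1\<close> norm of \<open>g\<close>, hence at most \<open>sqrt (b - a)\<close> times its
  \<open>L\<^sup>2\<close> norm; squaring and integrating costs another \<open>sqrt (b - a)\<close>.
\<close>

lemma L2_norm_primitive:
  assumes "a < b" and g: "g \<in> L2_space {a<..<b}"
  shows "primitive a b g \<in> L2_space {a<..<b}"
    and "L2_norm {a<..<b} (primitive a b g) \<le> (b - a) * L2_norm {a<..<b} g"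
proof -
  have gm [measurable]: "g \<in> borel_measurable (lebesgue_on {a<..<b})" using g by (simp add: L2_space_iff)
  have gi: "integrable (lebesgue_on {a<..<b}) g" by (rule L2_integrable(1)[OF _ g]) simp
  have bound: "\<bar>primitive a b g x\<bar> \<le> sqrt (b - a) * L2_norm {a<..<b} g" for x
  proof -
    have "\<bar>primitive a b g x\<bar> \<le> (\<integral>t. \<bar>if t < x then g t else 0\<bar> \<partial>lebesgue_on {a<..<b})"
      unfolding primitive_def by (rule integral_abs_bound)
    also have "\<dots> \<le> (\<integral>t. \<bar>g t\<bar> \<partial>lebesgue_on {a<..<b})"
      by (rule integral_mono') (use gi in auto)
    also have "\<dots> \<le> sqrt (b - a) * L2_norm {a<..<b} g"
      using L2_integrable(2)[OF _ g] \<open>a < b\<close> by simp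
    finally show ?thesis .
  qed
  have nonneg: "0 \<le> sqrt (b - a) * L2_norm {a<..<b} g" using \<open>a < b\<close> by simp
  note * = L2_bounded[OF _ primitive_measurable[OF gm] nonneg bound]
  show "primitive a b g \<in> L2_space {a<..<b}" by (rule *) simp
  have "L2_norm {a<..<b} (primitive a b g) \<le> sqrt (b - a) * L2_norm {a<..<b} g * sqrt (b - a)"
    using *(2) \<open>a < b\<close> by simp
  also have "\<dots> = (sqrt (b - a) * sqrt (b - a)) * L2_norm {a<..<b} g" by (simp only: mult_ac)
  finally show "L2_norm {a<..<b} (primitive a b g) \<le> (b - a) * L2_norm {a<..<b} g"
    using \<open>a < b\<close> by simp
qed

text \<open>
  The primitive is only absolutely continuous. Exchanging the order of integration replaces the product
  rule: the inner integral of \<open>\<phi>'\<close> over \<open>x > t\<close> is \<open>- \<phi> t\<close>.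
\<close>

lemma primitive_by_parts:
  assumes "a < b" and g: "integrable (lebesgue_on {a<..<b}) g" and \<phi>: "\<phi> \<in> test_functions {a<..<b}"
  shows "(\<integral>x. primitive a b g x * deriv \<phi> x \<partial>lebesgue_on {a<..<b})
       = - (\<integral>x. g x * \<phi> x \<partial>lebesgue_on {a<..<b})"
proof -
  let ?M = "lebesgue_on {a<..<b}"
  interpret pair_sigma_finite ?M ?M
    by (intro pair_sigma_finite.intro sigma_finite_lebesgue_on_Ioo)
  have \<phi>': "deriv \<phi> \<in> test_functions {a<..<b}" by (rule test_function_deriv[OF assms(1) \<phi>])
  have cont: "continuous_on UNIV (deriv \<phi>)" using \<phi>' by (intro smooth_continuous_on test_function_smooth)
  have [measurable]: "g \<in> borel_measurable ?M" "deriv \<phi> \<in> borel_measurable ?M"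
    using g test_function_measurable[OF \<phi>'] by auto
  obtain B where B: "0 \<le> B" "\<And>x. \<bar>deriv \<phi> x\<bar> \<le> B" using test_function_bounded[OF \<phi>'] by blast
  have tail: "(\<integral>x. (if t < x then deriv \<phi> x else 0) \<partial>?M) = - \<phi> t" if t: "t \<in> {a<..<b}" for t
  proof -
    have "(\<integral>x. (if t < x then deriv \<phi> x else 0) \<partial>?M) = integral\<^sup>L (lebesgue_on {t<..<b}) (deriv \<phi>)"
      using t by (simp add: integral_restrict_space) (auto simp: indicator_def intro!: Bochner_Integration.integral_cong)
    also have "\<dots> = \<phi> b - \<phi> t"
      using t by (intro integral_Ioo_FTC(2) cont smooth_DERIV test_function_smooth[OF \<phi>]) auto
    finally show ?thesis using test_function_endpoints[OF assms(1) \<phi>] by simp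
  qed
  define k where "k t x = (if t < x then g t * deriv \<phi> x else 0)" for t x
  have k_meas [measurable]: "case_prod k \<in> borel_measurable (?M \<Otimes>\<^sub>M ?M)"
    unfolding k_def by measurable
  have "integrable (?M \<Otimes>\<^sub>M ?M) (case_prod k)"
  proof (rule Fubini_integrable)
    have kx: "integrable ?M (k t)" for t
    proof (rule Bochner_Integration.integrable_bound)
      show "integrable ?M (\<lambda>x. g t * B)"
        by (intro finite_measure.integrable_const finite_measure_lebesgue_on) simp
      show "AE x in ?M. norm (k t x) \<le> norm (g t * B)"
        using B by (intro AE_I2) (auto simp: k_def abs_mult intro: mult_left_mono)
      have "(\<lambda>x. if t < x then g t * deriv \<phi> x else 0) \<in> borel_measurable ?M" by measurable
      then show "k t \<in> borel_measurable ?M" by (simp add: k_def[abs_def])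
    qed
    then show "AE t in ?M. integrable ?M (\<lambda>x. case_prod k (t, x))" by simp
    show "integrable ?M (\<lambda>t. \<integral>x. norm (case_prod k (t, x)) \<partial>?M)"
    proof (rule Bochner_Integration.integrable_bound)
      show "integrable ?M (\<lambda>t. \<bar>g t\<bar> * (B * (b - a)))" using g by simp
      have "(\<integral>x. \<bar>k t x\<bar> \<partial>?M) \<le> \<bar>g t\<bar> * (B * (b - a))" for t
      proof -
        have "(\<integral>x. \<bar>k t x\<bar> \<partial>?M) \<le> (\<integral>x. \<bar>g t\<bar> * B \<partial>?M)"
        proof (rule integral_mono)
          show "integrable ?M (\<lambda>x. \<bar>k t x\<bar>)" using kx by simp
          show "integrable ?M (\<lambda>x. \<bar>g t\<bar> * B)"
            by (intro finite_measure.integrable_const finite_measure_lebesgue_on) simp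
          show "\<bar>k t x\<bar> \<le> \<bar>g t\<bar> * B" for x
            using B by (auto simp: k_def abs_mult intro: mult_left_mono)
        qed
        then show ?thesis using \<open>a < b\<close> by (simp add: measure_restrict_space mult_ac)
      qed
      then show "AE t in ?M. norm (\<integral>x. norm (case_prod k (t, x)) \<partial>?M) \<le> norm (\<bar>g t\<bar> * (B * (b - a)))"
        using B \<open>a < b\<close> by (intro AE_I2) (simp add: abs_mult)
    qed measurable
  qed measurable
  note Fubini = Fubini_integral[OF this]
  have "(\<integral>x. primitive a b g x * deriv \<phi> x \<partial>?M) = (\<integral>x. (\<integral>t. k t x \<partial>?M) \<partial>?M)"
  proof (rule Bochner_Integration.integral_cong[OF refl])
    fix x
    have "primitive a b g x * deriv \<phi> x = (\<integral>t. (if t < x then g t else 0) * deriv \<phi> x \<partial>?M)"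
      unfolding primitive_def by simp
    then show "primitive a b g x * deriv \<phi> x = (\<integral>t. k t x \<partial>?M)"
      by (simp add: k_def if_distrib[of "\<lambda>y. y * _"] cong: if_cong)
  qed
  also have "\<dots> = (\<integral>t. (\<integral>x. k t x \<partial>?M) \<partial>?M)" by (rule Fubini)
  also have "\<dots> = (\<integral>t. - (g t * \<phi> t) \<partial>?M)"
  proof (rule Bochner_Integration.integral_cong[OF refl])
    fix t assume "t \<in> space ?M"
    then have "(\<integral>x. g t * (if t < x then deriv \<phi> x else 0) \<partial>?M) = g t * - \<phi> t"
      using tail by simp
    then show "(\<integral>x. k t x \<partial>?M) = - (g t * \<phi> t)"
      by (simp add: k_def if_distrib[of "\<lambda>y. _ * y"] cong: if_cong)
  qed
  finally show ?thesis by simp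
qed


section \<open>Polynomial approximation from a weak derivative\<close>

lemma integral_poly_mult_iterated_deriv:
  assumes "a < b" and \<phi>: "\<phi> \<in> test_functions {a<..<b}"
  shows "(\<integral>x. poly p x * (deriv ^^ m) \<phi> x \<partial>lebesgue_on {a<..<b})
       = (-1) ^ m * (\<integral>x. poly ((pderiv ^^ m) p) x * \<phi> x \<partial>lebesgue_on {a<..<b})"
  using \<phi>
proof (induction m arbitrary: \<phi>)
  case (Suc m)
  let ?I = "integral\<^sup>L (lebesgue_on {a<..<b})"
  define q where "q = (pderiv ^^ m) p"
  note \<phi>' = test_function_deriv[OF assms(1) Suc.prems]
  have cont: "continuous_on UNIV \<phi>" "continuous_on UNIV (deriv \<phi>)"
    using Suc.prems \<phi>' by (auto intro!: smooth_continuous_on test_function_smooth)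
  have D: "((\<lambda>x. poly q x * \<phi> x) has_field_derivative
      poly (pderiv q) x * \<phi> x + poly q x * deriv \<phi> x) (at x)" for x
    by (auto intro!: derivative_eq_intros smooth_DERIV test_function_smooth[OF Suc.prems])
  have "?I (\<lambda>x. poly (pderiv q) x * \<phi> x + poly q x * deriv \<phi> x) = 0"
    using test_function_endpoints[OF assms(1) Suc.prems] assms(1)
    by (subst integral_Ioo_FTC(2)[OF _ D]) (auto intro!: continuous_intros cont)
  moreover have "integrable (lebesgue_on {a<..<b}) (\<lambda>x. poly r x * \<psi> x)"
    if "\<psi> \<in> test_functions {a<..<b}" for r \<psi>
    using that by (intro L2_mult_integrable poly_L2 test_function_L2[where T = "{a<..<b}"]) auto
  ultimately have "?I (\<lambda>x. poly q x * deriv \<phi> x) = - ?I (\<lambda>x. poly (pderiv q) x * \<phi> x)"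
    using Suc.prems \<phi>' by simp
  then show ?case using Suc.IH[OF \<phi>']
    by (simp add: q_def funpow_swap1)
qed simp

lemma higher_pderiv_monom: "(pderiv ^^ m) (monom c m) = [:fact m * c:]"
  for c :: "'a :: field_char_0"
  by (induction m arbitrary: c) (simp_all add: funpow_Suc_right pderiv_monom monom_0 mult_ac del: funpow.simps)

text \<open>
  Modulo constants, the primitive of the weak derivative of order \<open>m + 1\<close> is a weak derivative of order
  \<open>m\<close>. Test functions that are derivatives of test functions are those of mean zero; an arbitrary \<open>\<psi>\<close> is
  made such by subtracting \<open>(\<integral> \<psi>) \<eta>\<close> with \<open>\<integral> \<eta> = 1\<close>, and the resulting error, a multiple of \<open>\<integral> \<psi>\<close>, is the
  constant \<open>c\<close>.
\<close>

lemma weak_derivative_reduce_order: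
  assumes "a < b" and f: "f \<in> L2_space {a<..<b}" and g: "g \<in> L2_space {a<..<b}"
    and weak: "\<And>\<phi>. \<phi> \<in> test_functions {a<..<b} \<Longrightarrow>
      (\<integral>x. f x * (deriv ^^ Suc m) \<phi> x \<partial>lebesgue_on {a<..<b})
        = (-1) ^ Suc m * (\<integral>x. g x * \<phi> x \<partial>lebesgue_on {a<..<b})"
  shows "\<exists>c. \<forall>\<psi>\<in>test_functions {a<..<b}.
      (\<integral>x. f x * (deriv ^^ m) \<psi> x \<partial>lebesgue_on {a<..<b})
        = (-1) ^ m * (\<integral>x. (primitive a b g x + c) * \<psi> x \<partial>lebesgue_on {a<..<b})"
proof -
  let ?I = "integral\<^sup>L (lebesgue_on {a<..<b})"
  define G where "G = primitive a b g"
  obtain \<eta> where \<eta>: "\<eta> \<in> test_functions {a<..<b}" "?I \<eta> = 1"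
    using normalised_test_function[OF assms(1)] by blast
  have G: "G \<in> L2_space {a<..<b}" unfolding G_def by (rule L2_norm_primitive(1)[OF assms(1) g])
  have gi: "integrable (lebesgue_on {a<..<b}) g" by (rule L2_integrable(1)[OF _ g]) simp
  have int: "integrable (lebesgue_on {a<..<b}) \<psi>"
      "integrable (lebesgue_on {a<..<b}) (\<lambda>x. h x * \<psi> x)"
    if "\<psi> \<in> test_functions {a<..<b}" "h \<in> L2_space {a<..<b}" for \<psi> h
    using test_function_L2[OF that(1), of "{a<..<b}"] that(2)
    by (auto intro: L2_mult_integrable L2_integrable(1))
  define c where "c = (-1) ^ m * ?I (\<lambda>x. f x * (deriv ^^ m) \<eta> x) - ?I (\<lambda>x. G x * \<eta> x)"
  have "?I (\<lambda>x. f x * (deriv ^^ m) \<psi> x) = (-1) ^ m * ?I (\<lambda>x. (G x + c) * \<psi> x)"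
    if \<psi>: "\<psi> \<in> test_functions {a<..<b}" for \<psi>
  proof -
    define \<zeta> where "\<zeta> = (\<lambda>x. 1 * \<psi> x + (- ?I \<psi>) * \<eta> x)"
    have "\<zeta> \<in> test_functions {a<..<b}"
      unfolding \<zeta>_def by (rule test_function_linear_combination[OF assms(1) \<psi> \<eta>(1)])
    moreover have "?I \<zeta> = 0"
      unfolding \<zeta>_def using int(1)[OF \<psi> f] int(1)[OF \<eta>(1) f] \<eta>(2) by simp
    ultimately obtain \<phi> where \<phi>: "\<phi> \<in> test_functions {a<..<b}" "deriv \<phi> = \<zeta>"
      using test_function_antiderivative[OF assms(1)] by blast
    have "(deriv ^^ Suc m) \<phi> = (deriv ^^ m) \<zeta>"
      by (simp add: funpow_Suc_right \<phi>(2) del: funpow.simps)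
    also have "\<dots> = (\<lambda>x. 1 * (deriv ^^ m) \<psi> x + (- ?I \<psi>) * (deriv ^^ m) \<eta> x)"
      unfolding \<zeta>_def
      by (intro iterated_deriv_linear_combination test_function_smooth[OF \<psi>] test_function_smooth[OF \<eta>(1)])
    finally have "?I (\<lambda>x. f x * (deriv ^^ Suc m) \<phi> x)
        = ?I (\<lambda>x. f x * (deriv ^^ m) \<psi> x - ?I \<psi> * (f x * (deriv ^^ m) \<eta> x))"
      by (simp add: algebra_simps del: funpow.simps)
    also have "\<dots> = ?I (\<lambda>x. f x * (deriv ^^ m) \<psi> x) - ?I \<psi> * ?I (\<lambda>x. f x * (deriv ^^ m) \<eta> x)"
      using int(2)[OF test_function_iterated_deriv[OF assms(1) \<psi>] f]
        int(2)[OF test_function_iterated_deriv[OF assms(1) \<eta>(1)] f] by simp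
    finally have left: "?I (\<lambda>x. f x * (deriv ^^ Suc m) \<phi> x)
      = ?I (\<lambda>x. f x * (deriv ^^ m) \<psi> x) - ?I \<psi> * ?I (\<lambda>x. f x * (deriv ^^ m) \<eta> x)" .
    have "- ?I (\<lambda>x. g x * \<phi> x) = ?I (\<lambda>x. G x * \<zeta> x)"
      using primitive_by_parts[OF assms(1) gi \<phi>(1)] by (simp add: G_def \<phi>(2))
    also have "\<dots> = ?I (\<lambda>x. G x * \<psi> x - ?I \<psi> * (G x * \<eta> x))"
      by (simp add: \<zeta>_def algebra_simps)
    also have "\<dots> = ?I (\<lambda>x. G x * \<psi> x) - ?I \<psi> * ?I (\<lambda>x. G x * \<eta> x)"
      using int(2)[OF \<psi> G] int(2)[OF \<eta>(1) G] by simp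
    finally have right: "- ?I (\<lambda>x. g x * \<phi> x)
      = ?I (\<lambda>x. G x * \<psi> x) - ?I \<psi> * ?I (\<lambda>x. G x * \<eta> x)" .
    have "?I (\<lambda>x. f x * (deriv ^^ m) \<psi> x) - ?I \<psi> * ?I (\<lambda>x. f x * (deriv ^^ m) \<eta> x)
        = (-1) ^ m * (?I (\<lambda>x. G x * \<psi> x) - ?I \<psi> * ?I (\<lambda>x. G x * \<eta> x))"
      using weak[OF \<phi>(1)] unfolding left right[symmetric] by simp
    moreover have "?I (\<lambda>x. (G x + c) * \<psi> x) = ?I (\<lambda>x. G x * \<psi> x) + c * ?I \<psi>"
      using int(2)[OF \<psi> G] int(1)[OF \<psi> G] by (simp add: distrib_right)
    moreover have "((-1::real) ^ m) * (-1) ^ m = 1" by (simp flip: power_mult_distrib)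
    moreover have "A = s * X"
      if "A - J * E = s * (P - J * Q)" "X = P + (s * E - Q) * J" "s * s = 1" for A E J P Q X s :: real
      using that by algebra
    ultimately show ?thesis unfolding c_def by blast
  qed
  then show ?thesis unfolding G_def by blast
qed

text \<open>
  Induction on the order: the weak derivative of order \<open>m + 1\<close> is integrated once, and the constant of
  integration is absorbed by a monomial of degree \<open>m\<close>, subtracted from \<open>f\<close>. Each integration gains a
  factor \<open>b - a\<close>. At order 0 the hypothesis says that \<open>f\<close> and \<open>g\<close> agree almost everywhere.
  
  The degree bound is stated through coefficients because for \<open>m = 0\<close> the polynomial must be 0, which
  \<open>degree\<close> cannot express.
\<close>

lemma polynomial_approximation:
  assumes "a < b" and f: "f \<in> L2_space {a<..<b}" and g: "g \<in> L2_space {a<..<b}"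
    and weak: "\<And>\<phi>. \<phi> \<in> test_functions {a<..<b} \<Longrightarrow>
      (\<integral>x. f x * (deriv ^^ m) \<phi> x \<partial>lebesgue_on {a<..<b})
        = (-1) ^ m * (\<integral>x. g x * \<phi> x \<partial>lebesgue_on {a<..<b})"
  shows "\<exists>p. (\<forall>i\<ge>m. coeff p i = 0) \<and>
    L2_norm {a<..<b} (\<lambda>x. f x - poly p x) \<le> (b - a) ^ m * L2_norm {a<..<b} g"
  using f g weak
proof (induction m arbitrary: f g)
  case 0
  have "AE x in lebesgue_on {a<..<b}. f x = g x"
    by (rule AE_eq_if_same_test_integrals) (use assms(1) 0 in \<open>auto intro: L2_imp_locally_integrable\<close>)
  then have "L2_norm {a<..<b} f = L2_norm {a<..<b} g"
    using 0 by (intro L2_norm_cong_AE) (auto simp: L2_space_iff)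
  then show ?case by (intro exI[of _ 0]) simp
next
  case (Suc m)
  let ?I = "integral\<^sup>L (lebesgue_on {a<..<b})"
  define G where "G = primitive a b g"
  note G = L2_norm_primitive[OF assms(1) Suc.prems(2), folded G_def]
  obtain c where c: "\<And>\<psi>. \<psi> \<in> test_functions {a<..<b} \<Longrightarrow>
      ?I (\<lambda>x. f x * (deriv ^^ m) \<psi> x) = (-1) ^ m * ?I (\<lambda>x. (G x + c) * \<psi> x)"
    using weak_derivative_reduce_order[OF assms(1) Suc.prems] unfolding G_def by blast
  define q where "q = monom (c / fact m) m"
  have q: "(pderiv ^^ m) q = [:c:]" by (simp add: q_def higher_pderiv_monom)
  have "?I (\<lambda>x. (f x - poly q x) * (deriv ^^ m) \<psi> x) = (-1) ^ m * ?I (\<lambda>x. G x * \<psi> x)"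
    if \<psi>: "\<psi> \<in> test_functions {a<..<b}" for \<psi>
  proof -
    have int: "integrable (lebesgue_on {a<..<b}) (\<lambda>x. h x * (deriv ^^ n) \<psi> x)"
      if "h \<in> L2_space {a<..<b}" for h n
      by (rule L2_mult_integrable[OF _ that test_function_L2[OF test_function_iterated_deriv[OF assms(1) \<psi>]]]) auto
    have int1: "integrable (lebesgue_on {a<..<b}) \<psi>"
      by (intro L2_integrable(1) test_function_L2[OF \<psi>]) auto
    have "?I (\<lambda>x. (f x - poly q x) * (deriv ^^ m) \<psi> x)
        = ?I (\<lambda>x. f x * (deriv ^^ m) \<psi> x) - ?I (\<lambda>x. poly q x * (deriv ^^ m) \<psi> x)"
      using int[OF Suc.prems(1), of m] int[OF poly_L2, of q m] by (simp add: left_diff_distrib)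
    also have "\<dots> = (-1) ^ m * (?I (\<lambda>x. (G x + c) * \<psi> x) - ?I (\<lambda>x. c * \<psi> x))"
      unfolding c[OF \<psi>] integral_poly_mult_iterated_deriv[OF assms(1) \<psi>] q
      by (simp add: right_diff_distrib)
    also have "?I (\<lambda>x. (G x + c) * \<psi> x) - ?I (\<lambda>x. c * \<psi> x) = ?I (\<lambda>x. G x * \<psi> x)"
      using int[OF G(1), of 0] int1 by (simp add: distrib_right)
    finally show ?thesis .
  qed
  from Suc.IH[OF _ G(1) this] obtain p where p: "\<forall>i\<ge>m. coeff p i = 0"
      "L2_norm {a<..<b} (\<lambda>x. (f x - poly q x) - poly p x) \<le> (b - a) ^ m * L2_norm {a<..<b} G"
    using L2_diff[OF _ Suc.prems(1) poly_L2, of q] by auto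
  have "\<forall>i\<ge>Suc m. coeff (q + p) i = 0" using p(1) by (simp add: q_def)
  moreover have "L2_norm {a<..<b} (\<lambda>x. f x - poly (q + p) x) \<le> (b - a) ^ m * L2_norm {a<..<b} G"
    using p(2) by (simp add: algebra_simps)
  moreover have "(b - a) ^ m * L2_norm {a<..<b} G \<le> (b - a) ^ m * ((b - a) * L2_norm {a<..<b} g)"
    using G(2) assms(1) by (intro mult_left_mono) auto
  ultimately show ?case by (intro exI[of _ "q + p"]) (simp add: mult_ac)
qed

section \<open>Monic Legendre polynomials\<close>

text \<open>
  Each differentiation lowers the multiplicity of a factor by at most one.
\<close>

lemma power_diff_dvd_higher_pderiv:
  fixes w :: "'a :: {comm_semiring_1, semiring_no_zero_divisors} poly"
  assumes "j \<le> n"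
  shows "w ^ (n - j) dvd (pderiv ^^ j) (w ^ n)"
  using assms
proof (induction j)
  case (Suc j)
  then obtain r where r: "(pderiv ^^ j) (w ^ n) = w ^ Suc (n - Suc j) * r"
    by (auto simp: Suc_diff_Suc elim!: dvdE)
  have "(pderiv ^^ Suc j) (w ^ n) = w ^ (n - Suc j) *
      (w * pderiv r + r * smult (of_nat (Suc (n - Suc j))) (pderiv w))"
    by (simp add: r pderiv_mult pderiv_power_Suc algebra_simps del: power_Suc of_nat_Suc) (simp add: mult_ac)
  then show ?case by (rule dvdI)
qed simp

text \<open>
  Repeated integration by parts at the level of polynomials. Each step moves one derivative onto \<open>q\<close>, until
  \<open>q\<close> is killed, and the boundary terms vanish at both ends because fewer than \<open>n\<close> differentiations leave
  a factor \<open>\<xi>\<^sup>2 - 1\<close>.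
\<close>

lemma Rodrigues_antiderivative:
  fixes q :: "real poly"
  assumes "j \<le> n" "(pderiv ^^ j) q = 0"
  shows "\<exists>R. pderiv R = q * (pderiv ^^ j) ([:-1, 0, 1:] ^ n) \<and> poly R 1 = 0 \<and> poly R (- 1) = 0"
  using assms
proof (induction j arbitrary: q)
  case 0
  then show ?case by (intro exI[of _ 0]) simp
next
  case (Suc j)
  let ?w = "[:-1, 0, 1:] :: real poly"
  have "(pderiv ^^ j) (pderiv q) = 0" using Suc.prems(2) by (simp add: funpow_swap1)
  then obtain R where R: "pderiv R = pderiv q * (pderiv ^^ j) (?w ^ n)" "poly R 1 = 0" "poly R (- 1) = 0"
    using Suc.IH Suc.prems(1) by fastforce
  have "?w dvd ?w ^ (n - j)" using Suc.prems(1) by (simp add: dvd_power)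
  also have "\<dots> dvd (pderiv ^^ j) (?w ^ n)" using Suc.prems(1) by (intro power_diff_dvd_higher_pderiv) simp
  finally obtain s where s: "(pderiv ^^ j) (?w ^ n) = ?w * s" by (elim dvdE)
  show ?case
    by (rule exI[of _ "q * (pderiv ^^ j) (?w ^ n) - R"])
       (simp add: pderiv_diff pderiv_mult R, simp add: s)
qed

lemma degree_higher_pderiv: "degree ((pderiv ^^ n) p) = degree p - n"
  for p :: "real poly"
  by (induction n) (simp_all add: degree_pderiv)

lemma degree_monic_Legendre: "degree (monic_Legendre n) = n"
  by (simp add: monic_Legendre_def degree_higher_pderiv degree_power_eq)

lemma higher_pderiv_eq_0: "degree p < n \<Longrightarrow> (pderiv ^^ n) p = 0"
  for p :: "real poly"
proof (induction n arbitrary: p)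
  case (Suc n)
  show ?case
  proof (cases "degree p = 0")
    case True
    then have "pderiv p = 0" by (simp add: pderiv_eq_0_iff)
    moreover have "(pderiv ^^ n) (0 :: real poly) = 0" by (induction n) auto
    ultimately show ?thesis by (simp add: funpow_Suc_right del: funpow.simps)
  next
    case False
    then show ?thesis using Suc by (simp add: funpow_Suc_right degree_pderiv del: funpow.simps)
  qed
qed simp

section \<open>The cell basis\<close>

definition cell_map :: "real \<Rightarrow> real \<Rightarrow> real poly" where
  "cell_map a b = [:- (a + b) / (b - a), 2 / (b - a):]"

lemma cell_basis_eq: "cell_basis a b i = pcompose (monic_Legendre i) (cell_map a b)"
  by (simp add: cell_basis_def cell_map_def)

lemma poly_cell_map:
  assumes "a < b"
  shows "poly (cell_map a b) x = (2 * x - (a + b)) / (b - a)"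
  by (simp add: cell_map_def diff_divide_distrib add_divide_distrib)

lemma cell_basis_0: "cell_basis a b 0 = 1"
  by (simp add: cell_basis_def monic_Legendre_values pcompose_1)

lemma cell_basis_1: "cell_basis a b 1 = cell_map a b"
  using monic_Legendre_values(2) by (simp add: cell_basis_eq pcompose_pCons)

lemma degree_cell_basis:
  assumes "a < b"
  shows "degree (cell_basis a b i) = i"
  using assms by (simp add: cell_basis_eq degree_pcompose degree_monic_Legendre cell_map_def)

lemma cell_basis_nonzero:
  assumes "a < b"
  shows "cell_basis a b i \<noteq> 0"
  using degree_cell_basis[OF assms, of i] cell_basis_0[of a b] by (cases "i = 0") auto

lemma cell_basis_span:
  assumes "a < b" "degree p \<le> k"
  shows "\<exists>c. p = (\<Sum>i\<le>k. smult (c i) (cell_basis a b i))"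
  using assms(2)
proof (induction k arbitrary: p)
  case 0
  then have "p = smult (coeff p 0) 1" by (simp add: degree_0_id)
  then show ?case by (intro exI[of _ "\<lambda>_. coeff p 0"]) (simp add: cell_basis_0)
next
  case (Suc k)
  let ?B = "cell_basis a b (Suc k)"
  define t where "t = coeff p (Suc k) / lead_coeff ?B"
  have "coeff (p - smult t ?B) i = 0" if "i > k" for i
  proof (cases "i = Suc k")
    case True
    then show ?thesis using cell_basis_nonzero[OF assms(1), of "Suc k"] degree_cell_basis[OF assms(1), of "Suc k"]
      by (simp add: t_def) (metis leading_coeff_0_iff nonzero_divide_eq_eq)
  next
    case False
    then show ?thesis using that Suc.prems degree_cell_basis[OF assms(1), of "Suc k"]
      by (simp add: coeff_eq_0)
  qed
  then have "degree (p - smult t ?B) \<le> k" by (simp add: degree_le)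
  then obtain c where "p - smult t ?B = (\<Sum>i\<le>k. smult (c i) (cell_basis a b i))"
    using Suc.IH by blast
  then have "p = (\<Sum>i\<le>k. smult (c i) (cell_basis a b i)) + smult t ?B" by (simp add: algebra_simps)
  also have "\<dots> = (\<Sum>i\<le>Suc k. smult ((c(Suc k := t)) i) (cell_basis a b i))" by simp
  finally show ?case by blast
qed

lemma integral_pderiv:
  fixes c d :: real
  assumes "c \<le> d"
  shows "(\<integral>x. poly (pderiv P) x \<partial>lebesgue_on {c<..<d}) = poly P d - poly P c"
  by (rule integral_Ioo_FTC(2)[of c d "poly P" "poly (pderiv P)"]) (use assms in \<open>auto intro!: poly_DERIV continuous_intros\<close>)

text \<open>
  On the reference interval the product of the two polynomials has an antiderivative that vanishes at both
  ends. Composing it with the affine map gives an antiderivative on the cell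
  with the same boundary values up to scaling.
\<close>

lemma cell_basis_orthogonal:
  assumes "a < b" "i \<noteq> j"
  shows "(\<integral>x. poly (cell_basis a b i) x * poly (cell_basis a b j) x \<partial>lebesgue_on {a<..<b}) = 0"
proof -
  have *: "(\<integral>x. poly (cell_basis a b i) x * poly (cell_basis a b j) x \<partial>lebesgue_on {a<..<b}) = 0"
    if "i < j" for i j
  proof -
    have "(pderiv ^^ j) (monic_Legendre i) = 0"
      using that by (intro higher_pderiv_eq_0) (simp add: degree_monic_Legendre)
    then obtain R0 where R0: "pderiv R0 = monic_Legendre i * (pderiv ^^ j) ([:-1, 0, 1:] ^ j)"
        "poly R0 1 = 0" "poly R0 (- 1) = 0"
      using Rodrigues_antiderivative by blast
    define R where "R = smult (fact j / fact (2 * j)) R0"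
    have R: "pderiv R = monic_Legendre i * monic_Legendre j" "poly R 1 = 0" "poly R (- 1) = 0"
      using R0 by (simp_all add: R_def pderiv_smult monic_Legendre_def[of j])
    define P where "P = smult ((b - a) / 2) (pcompose R (cell_map a b))"
    have "pderiv (cell_map a b) = [:2 / (b - a):]" by (simp add: cell_map_def pderiv_pCons)
    then have "pderiv P = cell_basis a b i * cell_basis a b j"
      using assms(1) R(1)
      by (simp add: P_def pderiv_smult pderiv_pcompose cell_basis_eq pcompose_mult flip: smult_smult)
         (simp add: field_simps)
    then have "(\<integral>x. poly (cell_basis a b i) x * poly (cell_basis a b j) x \<partial>lebesgue_on {a<..<b})
        = poly P b - poly P a"
      using integral_pderiv[of a b P] assms(1) by simp
    also have "\<dots> = 0"
    proof -
      have "poly (cell_map a b) a = - 1" "poly (cell_map a b) b = 1"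
        using assms(1) by (simp_all add: poly_cell_map field_simps)
      then show ?thesis using R by (simp add: P_def poly_pcompose)
    qed
    finally show ?thesis .
  qed
  show ?thesis
    using *[of i j] *[of j i] assms(2) by (cases "i < j") (simp_all add: mult.commute)
qed

lemma cell_basis_norm:
  "(\<integral>x. poly (cell_basis a b i) x * poly (cell_basis a b i) x \<partial>lebesgue_on {a<..<b})
    = (L2_norm {a<..<b} (poly (cell_basis a b i)))\<^sup>2"
  by (subst L2_norm_square) (simp_all add: power2_eq_square)

lemma L2_norm_poly_pos:
  assumes "a < b" "p \<noteq> 0"
  shows "0 < L2_norm {a<..<b} (poly p)"
proof (rule ccontr)
  let ?M = "lebesgue_on {a<..<b}"
  assume "\<not> ?thesis"
  then have "(\<integral>x. (poly p x)\<^sup>2 \<partial>?M) = 0"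
    by (metis L2_norm_nonneg L2_norm_square less_eq_real_def lmeasurable_interval(2) fmeasurableD power_zero_numeral)
  then have "AE x in ?M. poly p x = 0"
    using poly_L2[of p a b] by (subst (asm) integral_nonneg_eq_0_iff_AE) (auto simp: L2_space_iff)
  moreover have "AE x in ?M. poly p x \<noteq> 0"
  proof -
    have "negligible {x. poly p x = 0}" by (intro negligible_finite poly_roots_finite assms)
    then have "AE x in lebesgue. x \<notin> {x. poly p x = 0}"
      unfolding negligible_iff_null_sets by (rule AE_not_in)
    then show ?thesis by (simp add: AE_restrict_space_iff) (auto elim: eventually_mono)
  qed
  ultimately have "AE x in ?M. False" by eventually_elim simp
  then show False using assms(1)
    by (subst (asm) AE_iff_measurable[of "{a<..<b}"]) (auto simp: emeasure_restrict_space)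
qed

section \<open>Existence, uniqueness and stability of the projection\<close>

lemma module_smult: "module (smult :: 'a::comm_ring_1 \<Rightarrow> 'a poly \<Rightarrow> 'a poly)"
  by unfold_locales (simp_all add: smult_add_right smult_add_left)

lemma integrable_Ioo_sub:
  assumes "f \<in> L2_space {a<..<b}" "{c<..<d} \<subseteq> {a<..<b::real}"
  shows "integrable (lebesgue_on {c<..<d}) f"
proof -
  have "integrable (lebesgue_on {a<..<b}) f" using L2_integrable(1) assms(1) by blast
  then have "set_integrable lebesgue {a<..<b} f" by (simp add: set_integrable_iff_lebesgue_on)
  then have "set_integrable lebesgue {c<..<d} f"
    by (rule set_integrable_subset) (use assms in auto)
  then show ?thesis by (simp add: set_integrable_iff_lebesgue_on)
qed

text \<open>
  The conditions depend only on the residual \<open>f - p\<close>. In this form it is evident that adding to \<open>f\<close> a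
  polynomial of degree at most \<open>k\<close> adds the same polynomial to its projection.
\<close>

lemma is_cell_projection_iff:
  assumes "a < b" and f: "f \<in> L2_space {a<..<b}"
  shows "is_cell_projection k a b f p \<longleftrightarrow> degree p \<le> k \<and>
    (\<integral>x. f x - poly p x \<partial>lebesgue_on {a<..<(a + b) / 2}) = 0 \<and>
    (\<forall>i\<in>{0..k} - {1}. (\<integral>x. (f x - poly p x) * poly (cell_basis a b i) x \<partial>lebesgue_on {a<..<b}) = 0)"
proof -
  let ?I = "integral\<^sup>L (lebesgue_on {a<..<b})"
  interpret module "smult :: real \<Rightarrow> real poly \<Rightarrow> real poly" by (rule module_smult)
  have int: "integrable (lebesgue_on {a<..<b}) (\<lambda>x. h x * poly v x)" if "h \<in> L2_space {a<..<b}" for h v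
    by (rule L2_mult_integrable[OF _ that poly_L2]) simp
  have half: "{a<..<(a + b) / 2} \<subseteq> {a<..<b}" using assms(1) by auto
  have e: "(\<lambda>x. f x - poly p x) \<in> L2_space {a<..<b}" by (intro L2_diff f poly_L2) simp
  have sub: "?I (\<lambda>x. poly p x * poly v x) = ?I (\<lambda>x. f x * poly v x) \<longleftrightarrow>
      ?I (\<lambda>x. (f x - poly p x) * poly v x) = 0" for v
    using int[OF f, of v] int[OF poly_L2, of p v] by (simp add: left_diff_distrib) argo
  define Z where "Z = {v. ?I (\<lambda>x. (f x - poly p x) * poly v x) = 0}"
  have "subspace Z"
    unfolding Z_def
  proof (rule subspaceI)
    fix u v :: "real poly" and c
    assume *: "u \<in> {v. ?I (\<lambda>x. (f x - poly p x) * poly v x) = 0}"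
    show "smult c u \<in> {v. ?I (\<lambda>x. (f x - poly p x) * poly v x) = 0}"
      using * by (simp add: mult.left_commute[of _ c])
    assume **: "v \<in> {v. ?I (\<lambda>x. (f x - poly p x) * poly v x) = 0}"
    then show "u + v \<in> {v. ?I (\<lambda>x. (f x - poly p x) * poly v x) = 0}"
      using * int[OF e, of u] int[OF e, of v] by (simp add: distrib_left)
  qed simp
  then have span: "span B \<subseteq> Z \<longleftrightarrow> B \<subseteq> Z" for B
    using span_minimal span_superset by blast
  have "integrable (lebesgue_on {a<..<(a + b) / 2}) f" "integrable (lebesgue_on {a<..<(a + b) / 2}) (poly p)"
    using integrable_Ioo_sub[OF f half] integrable_Ioo_sub[OF poly_L2 half] by auto
  then have "(\<integral>x. poly p x \<partial>lebesgue_on {a<..<(a + b) / 2}) = (\<integral>x. f x \<partial>lebesgue_on {a<..<(a + b) / 2}) \<longleftrightarrow>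
      (\<integral>x. f x - poly p x \<partial>lebesgue_on {a<..<(a + b) / 2}) = 0"
    by simp argo
  moreover have "(\<forall>v\<in>span (cell_basis a b ` ({0..k} - {1})).
      ?I (\<lambda>x. poly p x * poly v x) = ?I (\<lambda>x. f x * poly v x)) \<longleftrightarrow>
      (\<forall>i\<in>{0..k} - {1}. ?I (\<lambda>x. (f x - poly p x) * poly (cell_basis a b i) x) = 0)"
    using span[of "cell_basis a b ` ({0..k} - {1})"] by (auto simp: sub Z_def)
  ultimately show ?thesis
    by (simp add: is_cell_projection_def set_integral_eq_lebesgue_on)
qed

text \<open>
  What matters is that this value is not 0: \<open>\<Phi>\<^sub>1\<close> is orthogonal to the other basis polynomials, but the
  half-cell condition sees it.
\<close>

lemma integral_cell_basis_1_half:
  assumes "a < b"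
  shows "(\<integral>x. poly (cell_basis a b 1) x \<partial>lebesgue_on {a<..<(a + b) / 2}) = - (b - a) / 4"
proof -
  define P where "P = smult ((b - a) / 4) ((cell_map a b)\<^sup>2)"
  have "pderiv P = cell_basis a b 1"
  proof -
    have "pderiv (cell_map a b) = [:2 / (b - a):]" by (simp add: cell_map_def pderiv_pCons)
    then have "pderiv P = smult ((b - a) / 4)
        (smult (2 / (b - a)) (cell_map a b) + smult (2 / (b - a)) (cell_map a b))"
      by (simp add: P_def power2_eq_square pderiv_smult pderiv_mult)
    also have "\<dots> = smult ((b - a) / 4 * (2 / (b - a) + 2 / (b - a))) (cell_map a b)"
      by (simp only: smult_add_left flip: smult_smult)
    also have "(b - a) / 4 * (2 / (b - a) + 2 / (b - a)) = 1"
      using assms by (simp flip: add_divide_distrib)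
    finally show ?thesis by (simp add: cell_basis_1 del: One_nat_def)
  qed
  then have "(\<integral>x. poly (cell_basis a b 1) x \<partial>lebesgue_on {a<..<(a + b) / 2}) = poly P ((a + b) / 2) - poly P a"
    using integral_pderiv[of a "(a + b) / 2" P] assms by simp
  also have "\<dots> = - (b - a) / 4"
  proof -
    have "poly (cell_map a b) a = - 1" "poly (cell_map a b) ((a + b) / 2) = 0"
      using assms by (simp_all add: poly_cell_map field_simps)
    then show ?thesis by (simp add: P_def field_simps)
  qed
  finally show ?thesis .
qed

text \<open>
  The difference of two candidates is orthogonal to every \<open>\<Phi>\<^sub>i\<close> with \<open>i \<noteq> 1\<close>, so it is a multiple of \<open>\<Phi>\<^sub>1\<close>; the
  half-cell condition makes the factor 0.
\<close>

lemma is_cell_projection_unique: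
  assumes "a < b" and f: "f \<in> L2_space {a<..<b}"
    and p: "is_cell_projection k a b f p" and q: "is_cell_projection k a b f q"
  shows "p = q"
proof -
  let ?I = "integral\<^sup>L (lebesgue_on {a<..<b})"
  let ?B = "cell_basis a b"
  have half: "{a<..<(a + b) / 2} \<subseteq> {a<..<b}" using assms(1) by auto
  have e: "(\<lambda>x. f x - poly r x) \<in> L2_space {a<..<b}" for r by (intro L2_diff f poly_L2) simp
  note p = p[unfolded is_cell_projection_iff[OF assms(1) f]] and q = q[unfolded is_cell_projection_iff[OF assms(1) f]]
  have "degree (p - q) \<le> k" using p q by (intro degree_diff_le) auto
  then obtain c where c: "p - q = (\<Sum>i\<le>k. smult (c i) (?B i))"
    using cell_basis_span[OF assms(1)] by blast
  have c0: "c i = 0" if i: "i \<in> {0..k} - {1}" for i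
  proof -
    have "?I (\<lambda>x. poly (p - q) x * poly (?B i) x)
      = ?I (\<lambda>x. (f x - poly q x) * poly (?B i) x - (f x - poly p x) * poly (?B i) x)"
      by (simp add: algebra_simps)
    also have "\<dots> = 0"
      using p q i L2_mult_integrable[OF _ e poly_L2, of q "?B i"] L2_mult_integrable[OF _ e poly_L2, of p "?B i"]
      by simp
    finally have "0 = ?I (\<lambda>x. \<Sum>j\<le>k. c j * (poly (?B j) x * poly (?B i) x))"
      by (simp add: c poly_sum sum_distrib_right mult.assoc)
    also have "\<dots> = (\<Sum>j\<le>k. c j * ?I (\<lambda>x. poly (?B j) x * poly (?B i) x))"
      using L2_mult_integrable[OF _ poly_L2 poly_L2, of a b] by (subst Bochner_Integration.integral_sum) auto
    also have "\<dots> = (\<Sum>j\<le>k. if j = i then c i * (L2_norm {a<..<b} (poly (?B i)))\<^sup>2 else 0)"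
      using cell_basis_orthogonal[OF assms(1)]
      by (intro sum.cong) (auto simp: cell_basis_norm)
    also have "\<dots> = c i * (L2_norm {a<..<b} (poly (?B i)))\<^sup>2" using i by simp
    finally show ?thesis
      using L2_norm_poly_pos[OF assms(1) cell_basis_nonzero[OF assms(1)], of i] by simp
  qed
  have "\<exists>t. p - q = smult t (?B 1)"
  proof (cases "k \<ge> 1")
    case True
    have "p - q = (\<Sum>i\<in>{1}. smult (c i) (?B i))"
      unfolding c using True c0 by (intro sum.mono_neutral_right) auto
    then show ?thesis by auto
  next
    case False
    then have "p - q = smult 0 (?B 1)" unfolding c using c0 by simp
    then show ?thesis by blast
  qed
  then obtain t where t: "p - q = smult t (?B 1)" by blast
  have "t * (- (b - a) / 4) = (\<integral>x. poly (p - q) x \<partial>lebesgue_on {a<..<(a + b) / 2})"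
    using integral_cell_basis_1_half[OF assms(1)] by (simp add: t)
  also have "\<dots> = (\<integral>x. (f x - poly q x) - (f x - poly p x) \<partial>lebesgue_on {a<..<(a + b) / 2})"
    by (simp add: algebra_simps)
  also have "\<dots> = 0"
    using p q integrable_Ioo_sub[OF e half, of q] integrable_Ioo_sub[OF e half, of p]
    by (subst Bochner_Integration.integral_diff) auto
  finally have "t = 0" using assms(1) by simp
  then show ?thesis using t by simp
qed

text \<open>
  The projection is the orthogonal projection \<open>Q\<close> on the \<open>\<Phi>\<^sub>i\<close> with \<open>i \<noteq> 1\<close> plus the multiple of \<open>\<Phi>\<^sub>1\<close> that
  corrects the mean over the left half of the cell. The first has at most \<open>k + 1\<close> terms, each of norm at most
  that of \<open>f\<close>, which gives the factor \<open>k + 2\<close> for the residual \<open>r = f - Q\<close>. In the second, the factor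
  \<open>4 / (b - a)\<close> from the half-cell mean of \<open>\<Phi>\<^sub>1\<close> is compensated by a factor \<open>sqrt (b - a)\<close> from the
  half-cell mean of \<open>r\<close> and another from the norm of \<open>\<Phi>\<^sub>1\<close>, so it adds at most 4 times the norm of \<open>r\<close>, and the
  constant is independent of the cell.
\<close>

lemma is_cell_projection_stable:
  assumes "a < b" "k \<ge> 1" and f: "f \<in> L2_space {a<..<b}"
  shows "\<exists>p. is_cell_projection k a b f p \<and>
    L2_norm {a<..<b} (\<lambda>x. f x - poly p x) \<le> 5 * (real k + 2) * L2_norm {a<..<b} f"
proof -
  let ?S = "{a<..<b}"
  let ?I = "integral\<^sup>L (lebesgue_on ?S)"
  let ?H = "integral\<^sup>L (lebesgue_on {a<..<(a + b) / 2})"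
  let ?B = "cell_basis a b"
  let ?J = "{0..k} - {1}"
  have S: "?S \<in> sets lebesgue" by simp
  have half: "{a<..<(a + b) / 2} \<subseteq> ?S" using assms(1) by auto
  define n where "n i = L2_norm ?S (poly (?B i))" for i
  have n: "n i > 0" for i unfolding n_def by (intro L2_norm_poly_pos assms(1) cell_basis_nonzero)
  define t where "t i = ?I (\<lambda>x. f x * poly (?B i) x) / (n i)\<^sup>2" for i
  define Q where "Q = (\<Sum>i\<in>?J. smult (t i) (?B i))"
  define r where "r x = f x - poly Q x" for x
  have r: "r \<in> L2_space ?S" unfolding r_def by (intro L2_diff f poly_L2 S)
  have Q_moments: "?I (\<lambda>x. r x * poly (?B i) x) = 0" if i: "i \<in> ?J" for i
  proof -
    have "?I (\<lambda>x. poly Q x * poly (?B i) x) = ?I (\<lambda>x. \<Sum>j\<in>?J. t j * (poly (?B j) x * poly (?B i) x))"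
      by (simp add: Q_def poly_sum sum_distrib_right mult.assoc)
    also have "\<dots> = (\<Sum>j\<in>?J. t j * ?I (\<lambda>x. poly (?B j) x * poly (?B i) x))"
      using L2_mult_integrable[OF S poly_L2 poly_L2] by (subst Bochner_Integration.integral_sum) auto
    also have "\<dots> = (\<Sum>j\<in>?J. if j = i then t i * (n i)\<^sup>2 else 0)"
      using cell_basis_orthogonal[OF assms(1)]
      by (intro sum.cong) (auto simp: n_def cell_basis_norm)
    also have "\<dots> = ?I (\<lambda>x. f x * poly (?B i) x)" using i n[of i] by (simp add: t_def)
    finally show ?thesis
      using L2_mult_integrable[OF S f poly_L2, of "?B i"] L2_mult_integrable[OF S poly_L2 poly_L2, of Q "?B i"]
      by (simp add: r_def left_diff_distrib)
  qed
  have "L2_norm ?S (poly Q) \<le> (\<Sum>i\<in>?J. L2_norm ?S (\<lambda>x. t i * poly (?B i) x))"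
  proof -
    have "poly Q = (\<lambda>x. \<Sum>i\<in>?J. t i * poly (?B i) x)" by (simp add: Q_def poly_sum fun_eq_iff)
    then show ?thesis using L2_norm_sum[OF S, of ?J "\<lambda>i x. t i * poly (?B i) x"] L2_cmult[OF S poly_L2] by simp
  qed
  also have "\<dots> \<le> (\<Sum>i\<in>?J. L2_norm ?S f)"
  proof (rule sum_mono)
    fix i
    have "\<bar>?I (\<lambda>x. f x * poly (?B i) x)\<bar> \<le> L2_norm ?S f * n i"
      unfolding n_def by (rule L2_Cauchy_Schwarz[OF S f poly_L2])
    then have "\<bar>t i\<bar> * n i \<le> L2_norm ?S f"
      using n[of i] by (simp add: t_def power2_eq_square field_simps)
    then show "L2_norm ?S (\<lambda>x. t i * poly (?B i) x) \<le> L2_norm ?S f"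
      by (simp add: L2_norm_cmult[OF S] n_def)
  qed
  also have "\<dots> \<le> (real k + 1) * L2_norm ?S f"
    using card_mono[of "{0..k}" ?J] S by (simp add: mult_right_mono)
  finally have "L2_norm ?S r \<le> L2_norm ?S f + (real k + 1) * L2_norm ?S f"
    unfolding r_def using L2_norm_triangle_diff[OF S f poly_L2, of Q] by simp
  then have r_norm: "L2_norm ?S r \<le> (real k + 2) * L2_norm ?S f" by (simp add: algebra_simps)
  define c where "c = - 4 / (b - a) * ?H r"
  define p where "p = Q + smult c (?B 1)"
  have fp: "f x - poly p x = r x - c * poly (?B 1) x" for x by (simp add: p_def r_def)
  have "is_cell_projection k a b f p"
    unfolding is_cell_projection_iff[OF assms(1) f]
  proof (intro conjI ballI)
    have "degree Q \<le> k" unfolding Q_def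
      by (intro degree_sum_le) (auto intro: order_trans[OF degree_smult_le] simp: degree_cell_basis[OF assms(1)])
    moreover have "degree (smult c (?B 1)) \<le> k"
      using degree_cell_basis[OF assms(1), of 1] assms(2) degree_smult_le[of c "?B 1"] by linarith
    ultimately show "degree p \<le> k" unfolding p_def by (rule degree_add_le)
    have "?H (\<lambda>x. f x - poly p x) = ?H r - c * ?H (poly (?B 1))"
      unfolding fp using integrable_Ioo_sub[OF r half] integrable_Ioo_sub[OF poly_L2 half, of "?B 1"] by simp
    moreover have "c * ?H (poly (?B 1)) = ?H r"
      unfolding integral_cell_basis_1_half[OF assms(1)] using assms(1) by (simp add: c_def field_simps)
    ultimately show "?H (\<lambda>x. f x - poly p x) = 0" by simp
    fix i assume i: "i \<in> ?J"
    have "?I (\<lambda>x. (f x - poly p x) * poly (?B i) x)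
        = ?I (\<lambda>x. r x * poly (?B i) x - c * (poly (?B 1) x * poly (?B i) x))"
      unfolding fp by (simp add: algebra_simps)
    also have "\<dots> = ?I (\<lambda>x. r x * poly (?B i) x) - c * ?I (\<lambda>x. poly (?B 1) x * poly (?B i) x)"
      using L2_mult_integrable[OF S r poly_L2, of "?B i"] L2_mult_integrable[OF S poly_L2 poly_L2, of "?B 1" "?B i"]
      by simp
    also have "\<dots> = 0" using Q_moments[OF i] cell_basis_orthogonal[OF assms(1), of 1 i] i by simp
    finally show "?I (\<lambda>x. (f x - poly p x) * poly (?B i) x) = 0" .
  qed
  moreover have "L2_norm ?S (\<lambda>x. f x - poly p x) \<le> 5 * (real k + 2) * L2_norm ?S f"
  proof -
    have B1: "L2_norm ?S (poly (?B 1)) \<le> 1 * sqrt (b - a)"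
    proof -
      have "\<bar>poly (?B 1) x\<bar> \<le> 1" if "x \<in> ?S" for x
        using that assms(1) unfolding cell_basis_1 poly_cell_map[OF assms(1)]
        by (simp add: abs_le_iff divide_le_eq)
      then show ?thesis
        using L2_bounded(2)[of ?S "poly (?B 1)" 1] poly_L2[of "?B 1" a b] assms(1) by (simp add: L2_space_iff)
    qed
    have "\<bar>?H r\<bar> \<le> ?H (\<lambda>x. \<bar>r x\<bar>)" by (rule integral_abs_bound)
    also have "\<dots> \<le> ?I (\<lambda>x. \<bar>r x\<bar>)"
    proof -
      have "integrable (lebesgue_on ?S) (\<lambda>x. \<bar>r x\<bar>)" using L2_integrable(1)[OF _ r] by simp
      moreover have "integrable (lebesgue_on {a<..<(a + b) / 2}) (\<lambda>x. \<bar>r x\<bar>)"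
        using integrable_Ioo_sub[OF r half] by simp
      ultimately show ?thesis
        using half by (simp add: integral_restrict_space integrable_restrict_space)
          (intro integral_mono, auto simp: indicator_def)
    qed
    also have "\<dots> \<le> sqrt (b - a) * L2_norm ?S r"
      using L2_integrable(2)[OF _ r] assms(1) by simp
    finally have "\<bar>c\<bar> \<le> 4 / (b - a) * (sqrt (b - a) * L2_norm ?S r)"
      using assms(1) by (simp add: c_def abs_mult divide_right_mono)
    then have "\<bar>c\<bar> * L2_norm ?S (poly (?B 1)) \<le> 4 / (b - a) * (sqrt (b - a) * L2_norm ?S r) * (1 * sqrt (b - a))"
      using B1 S assms(1) by (intro mult_mono) auto
    also have "\<dots> = 4 * ((sqrt (b - a) * sqrt (b - a)) / (b - a)) * L2_norm ?S r" by simp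
    also have "\<dots> = 4 * L2_norm ?S r" using assms(1) by simp
    finally have "L2_norm ?S (\<lambda>x. f x - poly p x) \<le> 5 * L2_norm ?S r"
      unfolding fp using L2_norm_triangle_diff[OF S r L2_cmult[OF S poly_L2], of c "?B 1"]
      by (simp add: L2_norm_cmult[OF S])
    also have "\<dots> \<le> 5 * ((real k + 2) * L2_norm ?S f)" using r_norm by simp
    finally show ?thesis by (simp only: mult.assoc)
  qed
  ultimately show ?thesis by blast
qed

section \<open>The error estimate\<close>

text \<open>
  The representative picked by \<open>weak_derivative\<close> is merely some weak derivative. It is square-integrable,
  as needed for its norm to be meaningful, because weak derivatives agree almost everywhere.
\<close>

lemma weak_derivative_L2:
  assumes "a < b" and "\<exists>g\<in>L2_space {a<..<b}. has_weak_derivative m {a<..<b} f g"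
  shows "has_weak_derivative m {a<..<b} f (weak_derivative m {a<..<b} f)"
    and "weak_derivative m {a<..<b} f \<in> L2_space {a<..<b}"
proof -
  let ?S = "{a<..<b}"
  define g where "g = weak_derivative m ?S f"
  obtain h where h: "h \<in> L2_space ?S" "has_weak_derivative m ?S f h" using assms(2) by blast
  have g: "has_weak_derivative m ?S f g"
    unfolding g_def weak_derivative_def using h(2) by (rule someI[where P = "has_weak_derivative m ?S f"])
  then show "has_weak_derivative m ?S f (weak_derivative m ?S f)" by (simp add: g_def)
  have "AE x in lebesgue_on ?S. h x = g x"
  proof (rule AE_eq_if_same_test_integrals[OF assms(1)])
    fix \<phi> assume "\<phi> \<in> test_functions ?S"
    then have "(-1) ^ m * (LINT x:?S|lebesgue. h x * \<phi> x) = (-1) ^ m * (LINT x:?S|lebesgue. g x * \<phi> x)"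
      using g h(2) by (simp add: has_weak_derivative_def)
    then show "(\<integral>x. h x * \<phi> x \<partial>lebesgue_on ?S) = (\<integral>x. g x * \<phi> x \<partial>lebesgue_on ?S)"
      by (simp add: set_integral_eq_lebesgue_on)
  qed (use g h in \<open>auto simp: has_weak_derivative_def\<close>)
  then have AE: "AE x in lebesgue. indicator ?S x *\<^sub>R h x = indicator ?S x *\<^sub>R g x"
    by (simp add: AE_restrict_space_iff) (auto elim: eventually_mono simp: indicator_def)
  have "(\<lambda>x. indicator ?S x *\<^sub>R h x) \<in> borel_measurable lebesgue"
    using h(1) by (simp add: L2_space_iff borel_measurable_restrict_space_iff)
  then have meas: "(\<lambda>x. indicator ?S x *\<^sub>R g x) \<in> borel_measurable lebesgue"
    by (rule borel_measurable_AE) (rule AE)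
  then have gm: "g \<in> borel_measurable (lebesgue_on ?S)"
    by (simp add: borel_measurable_restrict_space_iff)
  have "integrable (lebesgue_on ?S) (\<lambda>x. (g x)\<^sup>2)"
  proof (rule integrable_cong_AE_imp)
    show "integrable (lebesgue_on ?S) (\<lambda>x. (h x)\<^sup>2)" using h(1) by (simp add: L2_space_iff)
    show "AE x in lebesgue_on ?S. (h x)\<^sup>2 = (g x)\<^sup>2"
      using \<open>AE x in lebesgue_on ?S. h x = g x\<close> by eventually_elim simp
  qed (use gm in auto)
  then show "weak_derivative m ?S f \<in> L2_space ?S" using gm by (simp add: L2_space_iff g_def)
qed

text \<open>
  With \<open>p\<close> from the polynomial approximation and \<open>q\<close> the projection of \<open>e = f - p\<close>, the projection of \<open>f\<close> is
  \<open>p + q\<close>. The error is therefore that of \<open>e\<close>, which is at most a constant times the norm of \<open>e\<close>.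
\<close>

theorem theorem2p1:
  fixes k :: nat
  assumes "k \<ge> 1"
  shows "\<exists>C::real. \<forall>(a::real) (b::real) (f::real \<Rightarrow> real).
           a < b \<longrightarrow> f \<in> Sobolev_space (k + 1) {a<..<b} \<longrightarrow>
           L2_norm {a<..<b} (\<lambda>x. f x - cell_projection k a b f x)
             \<le> C * (b - a) ^ (k + 1) * Sobolev_seminorm (k + 1) {a<..<b} f"
proof (intro exI[of _ "5 * (real k + 2)"] allI impI)
  fix a b :: real and f :: "real \<Rightarrow> real"
  let ?S = "{a<..<b}"
  assume ab: "a < b" and sob: "f \<in> Sobolev_space (k + 1) ?S"
  define g where "g = weak_derivative (k + 1) ?S f"
  have f: "f \<in> L2_space ?S" using sob by (simp add: Sobolev_space_def)
  have "\<exists>g\<in>L2_space ?S. has_weak_derivative (k + 1) ?S f g"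
    using sob by (simp add: Sobolev_space_def)
  note g = weak_derivative_L2[OF ab this, folded g_def]
  have weak: "(\<integral>x. f x * (deriv ^^ (k + 1)) \<phi> x \<partial>lebesgue_on ?S)
        = (-1) ^ (k + 1) * (\<integral>x. g x * \<phi> x \<partial>lebesgue_on ?S)" if "\<phi> \<in> test_functions ?S" for \<phi>
  proof -
    have "(LINT x:?S|lebesgue. f x * (deriv ^^ (k + 1)) \<phi> x)
        = (-1) ^ (k + 1) * (LINT x:?S|lebesgue. g x * \<phi> x)"
      using g(1) that unfolding has_weak_derivative_def by blast
    then show ?thesis by (simp add: set_integral_eq_lebesgue_on del: funpow.simps)
  qed
  obtain p where p: "\<forall>i\<ge>k + 1. coeff p i = 0"
      "L2_norm ?S (\<lambda>x. f x - poly p x) \<le> (b - a) ^ (k + 1) * L2_norm ?S g"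
    using polynomial_approximation[OF ab f g(2) weak] by blast
  have "degree p \<le> k" using p(1) by (intro degree_le) simp
  define e where "e x = f x - poly p x" for x
  have e: "e \<in> L2_space ?S" unfolding e_def by (intro L2_diff f poly_L2) simp
  obtain q where q: "is_cell_projection k a b e q"
      "L2_norm ?S (\<lambda>x. e x - poly q x) \<le> 5 * (real k + 2) * L2_norm ?S e"
    using is_cell_projection_stable[OF ab assms e] by blast
  have "is_cell_projection k a b f (p + q)"
    using q(1) \<open>degree p \<le> k\<close> degree_add_le[of p k q]
    unfolding is_cell_projection_iff[OF ab f] is_cell_projection_iff[OF ab e]
    by (simp add: e_def diff_diff_eq)
  then have "(THE r. is_cell_projection k a b f r) = p + q"
    by (intro the_equality is_cell_projection_unique[OF ab f])
  then have "f x - cell_projection k a b f x = e x - poly q x" for x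
    by (simp add: cell_projection_def e_def)
  then have "L2_norm ?S (\<lambda>x. f x - cell_projection k a b f x) \<le> 5 * (real k + 2) * L2_norm ?S e"
    using q(2) by simp
  also have "\<dots> \<le> 5 * (real k + 2) * ((b - a) ^ (k + 1) * L2_norm ?S g)"
    using p(2) unfolding e_def by (intro mult_left_mono) auto
  finally show "L2_norm ?S (\<lambda>x. f x - cell_projection k a b f x)
      \<le> 5 * (real k + 2) * (b - a) ^ (k + 1) * Sobolev_seminorm (k + 1) ?S f"
    by (simp add: Sobolev_seminorm_def g_def mult.assoc)
qed

end
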